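(* Let $n,d$ be positive integers and let $k\ge d$ be an integer. Let $R_k$ be the set of polynomials of the form $$q(x_1)=\sum_{j=0}^{d}h_{2j}L_{2j}(x_1)+\sum_{j=d+1}^{k}b_jL_{2j}(x_1),\qquad b_j\in\mathbb{R},$$ where $L_j$ denotes the Legendre polynomial of degree $j$. Then $$\alpha(\mathcal{F}_k)\le 1-\sup_{q\in R_k}\ \min_{x_1\in[-1,1]}q(x_1).$$ In particular, any polynomial $q\in R_k$ gives an upper bound $\alpha(\mathcal{F}_k)\le 1-\min_{x_1\in[-1,1]}q(x_1)$.
   Context: $h_0:=1$ and $h_m:=\binom{n+m-1}{n-1}-\binom{n+m-3}{n-1}$ for $m\ge1$. The Legendre polynomial is $L_m(x_1)=\frac{1}{m!\,2^m}\frac{d^m}{dx_1^m}[(x_1^2-1)^m]$. Let $X=S^{n-1}\subseteq\mathbb{R}^n$ with normalized surface measure $\mu$ (so $\mu(X)=1$). Let $V=\mathrm{Sym}^{2d}(\mathbb{R}^n)$ and $\phi:X\to V$, $\phi(v)=v^{2d}$. The dual $V^*$ is identified with homogeneous polynomials of degree $2d$ in $n$ variables, via $\langle p,v^{2d}\rangle=p(v)$. Let $g\in V^*$ be the form $(x_1^2+\dots+x_n^2)^d$, and let $\overline{x}=\int_X\phi\,d\mu$, so $\langle p,\overline{x}\rangle=\int_{S^{n-1}}p\,d\mu$. Let $C$ be the convex cone generated by $\phi(X)$; its dual $C^*\subseteq V^*$ is the cone of nonnegative forms of degree $2d$ in $n$ variables. Let $\mathcal{F}_k$ be the vector space of homogeneous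 polynomials of degree $2k$ in $n$ variables restricted to $X$, and let $C^*(\mathcal{F}_k)=\{\lambda\in V^*:\int_X\lambda(u)q(u)^2d\mu(u)\ge0\ \forall q\in\mathcal{F}_k\}$. Let $\Lambda^\vee=\{\ell\in V^*:\ell(\overline{x})=1\}$, $B^\vee=C^*\cap\Lambda^\vee$ and $B^\vee(\mathcal{F}_k)=C^*(\mathcal{F}_k)\cap\Lambda^\vee$. The scaling constant $\alpha(\mathcal{F}_k)$ is the infimum of the real numbers $\alpha>0$ such that $\frac1\alpha(B^\vee(\mathcal{F}_k)-g)\subseteq B^\vee-g$ ($\infty$ if there are none). (Equivalently: with $C(\mathcal{F}_k)=C^*(\mathcal{F}_k)^*\subseteq V$, $\Lambda=g^{-1}(1)$, $B=C\cap\Lambda$, $B(\mathcal{F}_k)=C(\mathcal{F}_k)\cap\Lambda$, the inclusion $B-\overline{x}\subseteq\alpha(B(\mathcal{F}_k)-\overline{x})$.)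
   Formalization: L_j is taken as the Legendre polynomial of S^{n-1} (Gegenbauer, parameter (n-2)/2, L_j(1)=1; for n=1, L_j=0 when j≥1), which is the classical one only for n=3; with the classical L_j the claim fails, e.g. n=2, d=1, k=2, b_2=1 would give α≤23/35 although α≥1. *)

theory Defs
  imports "HOL-Analysis.Analysis" "HOL-Computational_Algebra.Polynomial"
begin

text \<open>Homogeneous polynomials in \<open>n = CARD('n)\<close> real variables, as polynomial functions:
  the exponent vectors of the monomials of degree \<open>m\<close> are the \<open>e :: 'n \<Rightarrow> nat\<close> with entries
  summing to \<open>m\<close>. The space \<open>forms (2 * d)\<close> is \<open>V\<^sup>*\<close> for \<open>V = Sym\<^sup>2\<^sup>d(\<real>\<^sup>n)\<close>, the pairing being
  \<open>\<langle>p, v\<^sup>2\<^sup>d\<rangle> = p(v)\<close>.\<close>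

definition forms :: "nat \<Rightarrow> (real ^ 'n::finite \<Rightarrow> real) set" where
  "forms m = {p. \<exists>c :: ('n \<Rightarrow> nat) \<Rightarrow> real.
     p = (\<lambda>x. \<Sum>e | (\<Sum>i\<in>UNIV. e i) = m. c e * (\<Prod>i\<in>UNIV. (x $ i) ^ e i))}"

text \<open>The normalized surface measure on the unit sphere, as the normalized cone measure: the
  measure of \<open>A\<close> is the proportion of the unit ball lying in the cone over \<open>A\<close>. The space of
  this measure is the sphere. For \<open>n = 1\<close> it gives mass \<open>1/2\<close> to each of the two points.\<close>

definition sphere_measure :: "(real ^ 'n::finite) measure" where
  "sphere_measure =
     restrict_space (distr (uniform_measure lborel (ball 0 1)) borel (\<lambda>x. x /\<^sub>R norm x)) (sphere 0 1)"

definition norm_form :: "nat \<Rightarrow> real ^ 'n::finite \<Rightarrow> real" where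
  "norm_form d x = (\<Sum>i\<in>UNIV. (x $ i)\<^sup>2) ^ d"

text \<open>The affine hyperplane \<open>\<Lambda>\<^sup>\<or>\<close> of the forms taking the value 1 on \<open>\<integral>\<phi> d\<mu>\<close>.\<close>

definition dual_hyperplane :: "nat \<Rightarrow> (real ^ 'n::finite \<Rightarrow> real) set" where
  "dual_hyperplane d = {l \<in> forms (2 * d). (\<integral>u. l u \<partial>sphere_measure) = 1}"

definition nonneg_forms :: "nat \<Rightarrow> (real ^ 'n::finite \<Rightarrow> real) set" where
  "nonneg_forms d = {p \<in> forms (2 * d). \<forall>x. 0 \<le> p x}"

text \<open>\<open>C\<^sup>*(F)\<close>, for a set \<open>F\<close> of functions on the sphere.\<close>

definition dual_cone :: "nat \<Rightarrow> (real ^ 'n::finite \<Rightarrow> real) set \<Rightarrow> (real ^ 'n \<Rightarrow> real) set" where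
  "dual_cone d F = {l \<in> forms (2 * d). \<forall>q\<in>F. 0 \<le> (\<integral>u. l u * (q u)\<^sup>2 \<partial>sphere_measure)}"

definition sphere_forms :: "nat \<Rightarrow> (real ^ 'n::finite \<Rightarrow> real) set" where
  "sphere_forms k = (\<lambda>p. restrict p (sphere 0 1)) ` forms (2 * k)"

definition dual_base :: "nat \<Rightarrow> (real ^ 'n::finite \<Rightarrow> real) set" where
  "dual_base d = nonneg_forms d \<inter> dual_hyperplane d"

definition dual_base_approx ::
    "nat \<Rightarrow> (real ^ 'n::finite \<Rightarrow> real) set \<Rightarrow> (real ^ 'n \<Rightarrow> real) set" where
  "dual_base_approx d F = dual_cone d F \<inter> dual_hyperplane d"

text \<open>The infimum is taken in the extended reals, so it is \<open>\<infinity>\<close> when no scaling works.\<close>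

definition scaling_constant :: "nat \<Rightarrow> (real ^ 'n::finite \<Rightarrow> real) set \<Rightarrow> ereal" where
  "scaling_constant d F = Inf (ereal ` {a. 0 < a \<and>
     (\<lambda>l x. (1 / a) * (l x - norm_form d x)) ` dual_base_approx d F
       \<subseteq> (\<lambda>l x. l x - norm_form d x) ` dual_base d})"

text \<open>\<open>h\<^sub>m\<close>. Truncated subtraction agrees with integer subtraction here, except for \<open>n = m = 1\<close>,
  where the second binomial coefficient is \<open>1\<close> (as for \<open>-1\<close> over \<open>0\<close>).\<close>

definition harm_dim :: "nat \<Rightarrow> nat \<Rightarrow> real" where
  "harm_dim n m = (if m = 0 then 1
     else real ((n + m - 1) choose (n - 1)) - real ((n + m - 3) choose (n - 1)))"

text \<open>The Legendre polynomials of the sphere in \<open>\<real>\<^sup>n\<close>, normalized to be 1 at 1 (for \<open>n \<ge> 2\<close>; they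
  are Gegenbauer polynomials of parameter \<open>(n - 2) / 2\<close>), given by Rodrigues' formula
  \[ L_m(x) = \frac{(-1)^m}{2^m\,((n-1)/2)_m}\,(1-x^2)^{-(n-3)/2}\,
       \frac{d^m}{dx^m}\,(1-x^2)^{m+(n-3)/2} \]
  where \<open>(a)\<^sub>m\<close> is the Pochhammer symbol; \<open>legendre_rodrigues\<close> below states it literally. For
  \<open>n = 3\<close> it is the classical formula with factor \<open>1 / (m! 2\<^sup>m)\<close>, see \<open>legendre_3\<close>. For general \<open>n\<close> the
  dimension-dependent polynomials are needed for \<open>h\<^sub>m L\<^sub>m(\<langle>u, v\<rangle>)\<close> to be the reproducing kernel of
  the harmonic forms of degree \<open>m\<close> on the sphere.

  In the definition, \<open>(-1)\<^sup>i (d/dx)\<^sup>i (1 - x\<^sup>2)\<^sup>a = (1 - x\<^sup>2)\<^sup>a\<^sup>-\<^sup>i R\<^sub>i(x)\<close> with \<open>R\<^sub>i = rodrigues_poly a i\<close>.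

  For \<open>n = 1\<close> the Pochhammer symbol vanishes for \<open>m \<ge> 1\<close>, so that \<open>L\<^sub>m = 0\<close>. For even \<open>m > 0\<close>
  this is the zonal harmonic, as there are no nonzero harmonic forms of degree \<open>m\<close>
  in one variable.\<close>

primrec rodrigues_poly :: "real \<Rightarrow> nat \<Rightarrow> real poly" where
  "rodrigues_poly a 0 = 1"
| "rodrigues_poly a (Suc i) =
     [:-1, 0, 1:] * pderiv (rodrigues_poly a i) + [:0, 2 * (a - real i):] * rodrigues_poly a i"

definition legendre :: "nat \<Rightarrow> nat \<Rightarrow> real poly" where
  "legendre n m =
     smult (1 / (2 ^ m * pochhammer ((real n - 1) / 2) m))
       (rodrigues_poly (real m + (real n - 3) / 2) m)"

lemma rodrigues_poly_deriv:
  assumes "\<bar>x\<bar> < 1"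
  shows "(deriv ^^ i) (\<lambda>t. (1 - t\<^sup>2) powr a) x =
    (-1) ^ i * (1 - x\<^sup>2) powr (a - real i) * poly (rodrigues_poly a i) x"
  using assms
proof (induction i arbitrary: x)
  case (Suc i)
  let ?f = "\<lambda>t. (-1) ^ i * (1 - t\<^sup>2) powr (a - real i) * poly (rodrigues_poly a i) t"
  have pos: "1 - x\<^sup>2 > 0"
    using Suc.prems by (simp add: abs_square_less_1)
  have "\<forall>\<^sub>F t in nhds x. t \<in> {-1<..<1}"
    using Suc.prems by (intro eventually_nhds_in_open) auto
  then have "\<forall>\<^sub>F t in nhds x. (deriv ^^ i) (\<lambda>t. (1 - t\<^sup>2) powr a) t = ?f t"
    by eventually_elim (auto intro!: Suc.IH)
  then have "(deriv ^^ Suc i) (\<lambda>t. (1 - t\<^sup>2) powr a) x = deriv ?f x"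
    by (auto intro!: deriv_cong_ev)
  also have "(?f has_real_derivative
      (-1) ^ i * ((1 - x\<^sup>2) powr (a - real i) * poly (pderiv (rodrigues_poly a i)) x
        + ((a - real i) * (1 - x\<^sup>2) powr (a - real i - 1) * (- 2 * x)) * poly (rodrigues_poly a i) x))
      (at x)"
    using pos by (auto intro!: derivative_eq_intros simp: algebra_simps)
  then have "deriv ?f x = 
      (-1) ^ i * ((1 - x\<^sup>2) powr (a - real i) * poly (pderiv (rodrigues_poly a i)) x
        + ((a - real i) * (1 - x\<^sup>2) powr (a - real i - 1) * (- 2 * x)) * poly (rodrigues_poly a i) x)"
    by (rule DERIV_imp_deriv)
  also have "(1 - x\<^sup>2) powr (a - real i) = (1 - x\<^sup>2) * (1 - x\<^sup>2) powr (a - real i - 1)"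
    using pos by (simp add: powr_diff)
  finally show ?case
    by (simp add: algebra_simps power2_eq_square)
qed simp

lemma legendre_rodrigues:
  assumes "\<bar>x\<bar> < 1"
  shows "poly (legendre n m) x = (-1) ^ m / (2 ^ m * pochhammer ((real n - 1) / 2) m)
    * (1 - x\<^sup>2) powr (- (real n - 3) / 2)
    * (deriv ^^ m) (\<lambda>t. (1 - t\<^sup>2) powr (real m + (real n - 3) / 2)) x"
proof -
  have "1 - x\<^sup>2 > 0"
    using assms by (simp add: abs_square_less_1)
  then have "(1 - x\<^sup>2) powr (- (real n - 3) / 2) * (1 - x\<^sup>2) powr ((real n - 3) / 2) = 1"
    by (simp flip: powr_add add: field_simps)
  then show ?thesis
    using assms by (simp add: legendre_def rodrigues_poly_deriv mult_ac flip: power_mult_distrib)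
qed

lemma legendre_3:
  "legendre 3 m = smult (1 / (fact m * 2 ^ m)) ((pderiv ^^ m) ([:-1, 0, 1:] ^ m))"
proof -
  have "(pderiv ^^ i) ([:-1, 0, 1:] ^ m) = [:-1, 0, 1:] ^ (m - i) * rodrigues_poly (real m) i"
    if "i \<le> m" for i
    using that
  proof (induction i)
    case (Suc i)
    then obtain j where j: "m = Suc (i + j)"
      by (metis Suc_le_D Suc_le_mono add_Suc le_Suc_ex plus_1_eq_Suc)
    have "pderiv ([:-1, 0, 1:] ^ Suc j :: real poly)
        = [:-1, 0, 1:] ^ j * [:0, 2 * (real m - real i):]"
      by (simp only: pderiv_power_Suc) (simp add: pderiv_pCons j algebra_simps)
    with Suc j show ?case
      by (simp add: pderiv_mult algebra_simps del: power_Suc)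
         (simp add: algebra_simps)
  qed simp
  from this[of m] show ?thesis
    by (simp add: legendre_def pochhammer_fact mult.commute)
qed

text \<open>\<open>R\<^sub>k\<close>: the coefficients up to \<open>j = d\<close> are prescribed, the higher ones are arbitrary.\<close>

definition kernel_polys :: "nat \<Rightarrow> nat \<Rightarrow> nat \<Rightarrow> real poly set" where
  "kernel_polys n d k = {q. \<exists>b :: nat \<Rightarrow> real.
     q = (\<Sum>j=0..d. smult (harm_dim n (2 * j)) (legendre n (2 * j)))
       + (\<Sum>j=d+1..k. smult (b j) (legendre n (2 * j)))}"

text \<open>The minimum of a polynomial over \<open>[-1, 1]\<close> is written as an infimum, which is attained.\<close>

lemma poly_INF_attained:
  fixes q :: "real poly"
  shows "\<exists>x\<in>{-1..1}. poly q x = (INF x\<in>{-1..1}. poly q x) \<and> (\<forall>y\<in>{-1..1}. poly q x \<le> poly q y)"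
proof -
  have "continuous_on {-1..1} (poly q)"
    by (intro continuous_intros)
  then obtain x where x: "x \<in> {-1..1}" "\<forall>y\<in>{-1..1}. poly q x \<le> poly q y"
    using continuous_attains_inf[of "{-1..1::real}" "poly q"] by auto
  then have "(INF x\<in>{-1..1}. poly q x) = poly q x"
    by (intro cInf_eq_minimum) auto
  with x show ?thesis
    by metis
qed

end

theory Submission
  imports Defs
begin

text \<open>Fix \<open>q \<in> R\<^sub>k\<close>, let \<open>M\<close> be its minimum on \<open>[-1, 1]\<close> and let \<open>l\<close> be a form of degree \<open>2d\<close> with
  \<open>\<integral> l d\<mu> = 1\<close> that satisfies the square conditions of \<open>C\<^sup>*(F\<^sub>k)\<close>. Everything follows from the
  inequality \<open>l(v) \<ge> M\<close> at all unit vectors \<open>v\<close> (\<open>dual_base_approx_ge\<close>): since \<open>g = 1\<close> on the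
  sphere, it says that \<open>g + (l - g) / \<alpha>\<close> is nonnegative for all positive \<open>\<alpha> \<ge> 1 - M\<close>. Two facts
  give it.

  The first is the reproducing property \<open>l(v) = \<integral> l(u) q(\<langle>u, v\<rangle>) d\<mu>(u)\<close>
  (\<open>form_kernel_reproducing\<close>). By rotation, \<open>v\<close> is a coordinate vector. Invariance of \<open>\<mu>\<close> under the
  rotations of a coordinate plane, differentiated at the identity (\<open>sphere_integral_rotation\<close>), is
  an integration by parts on the sphere; it replaces a monomial in the coordinates orthogonal to
  \<open>v\<close> by a multiple of a power of \<open>1 - \<langle>u, v\<rangle>\<^sup>2\<close>, whatever function of \<open>\<langle>u, v\<rangle>\<close> it is integrated
  against (\<open>monomial_zonal\<close>). This leaves a statement about the functional
  \<open>J(p) = \<integral> p(\<langle>u, v\<rangle>) d\<mu>(u)\<close> on polynomials in one variable. Again by invariance, \<open>J\<close> satisfies the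
  integration by parts rule of the weight \<open>(1 - x\<^sup>2)\<^bsup>(n-3)/2\<^esup>\<close>. For \<open>n \<ge> 2\<close> that rule alone makes
  the polynomials of Rodrigues' formula orthogonal with \<open>J(L\<^sub>m\<^sup>2) = 1 / h\<^sub>m\<close>, so that integration against \<open>q\<close> sends a
  polynomial \<open>r\<close> of degree at most \<open>2d\<close> to \<open>(r(1) + r(-1)) / 2\<close>: on \<open>L\<^sub>m\<close> both sides are \<open>1\<close> for
  even and \<open>0\<close> for odd \<open>m\<close> (\<open>kernel_reproducing\<close>).

  The second fact is \<open>\<integral> l(u) (q(\<langle>u, v\<rangle>) - M) d\<mu>(u) \<ge> 0\<close>. Here \<open>q(x) - M = P(x\<^sup>2)\<close> with \<open>P\<close> of degree
  at most \<open>k\<close> and nonnegative on \<open>[0, 1]\<close>. Subtracting from \<open>P\<close> its minimum makes it divisible by one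
  of \<open>y\<close>, \<open>1 - y\<close> and \<open>(y - y\<^sub>0)\<^sup>2\<close> with a quotient that is nonnegative again
  (\<open>nonneg_poly_peel_minimum\<close>), and at \<open>y = \<langle>u, v\<rangle>\<^sup>2\<close> each of these factors is a sum of squares of
  forms on the sphere. Hence \<open>P(\<langle>u, v\<rangle>\<^sup>2)\<close> is a sum of squares of forms of degree at most \<open>2k\<close>, and
  the hypothesis on \<open>l\<close> applies (\<open>dual_cone_zonal_nonneg\<close>).\<close>


section \<open>The normalized surface measure\<close>

lemma nn_integral_lborel_translate:
  fixes c :: "'a::euclidean_space"
  assumes [measurable]: "f \<in> borel_measurable borel"
  shows "(\<integral>\<^sup>+x. f (x + c) \<partial>lborel) = (\<integral>\<^sup>+x. f x \<partial>lborel)"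
proof -
  have "(\<integral>\<^sup>+x. f x \<partial>lborel) = (\<integral>\<^sup>+x. f x \<partial>distr lborel borel ((+) c))"
    by (simp add: lborel_distr_plus)
  also have "\<dots> = (\<integral>\<^sup>+x. f (x + c) \<partial>lborel)"
    by (simp add: nn_integral_distr add.commute)
  finally show ?thesis ..
qed

lemma nn_integral_lborel_reflect:
  fixes c :: "'a::euclidean_space"
  assumes [measurable]: "f \<in> borel_measurable borel"
  shows "(\<integral>\<^sup>+x. f (c - x) \<partial>lborel) = (\<integral>\<^sup>+x. f x \<partial>lborel)"
proof -
  have "(\<integral>\<^sup>+x. f x \<partial>lborel) = (\<integral>\<^sup>+x. f x \<partial>density (distr lborel borel (\<lambda>x. c + (- 1) *\<^sub>R x)) (\<lambda>_. ennreal (\<bar>- 1\<bar> ^ DIM('a))))"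
    by (subst lborel_affine[of "-1" c]) simp_all
  then show ?thesis
    by (simp add: nn_integral_density nn_integral_distr)
qed

text \<open>Uniqueness of translation-invariant measures, in the form of a double counting: for the unit
  ball \<open>B\<close>, which \<open>T\<close> preserves, the product \<open>\<lambda>(T\<^sup>-\<^sup>1 A) \<lambda>(B)\<close> is turned into \<open>\<lambda>(A) \<lambda>(B)\<close> by translations and
  Tonelli's theorem only, and then \<open>\<lambda>(B)\<close> is cancelled. No determinant enters, so this works in every
  Euclidean space.\<close>

lemma lborel_distr_orthogonal:
  fixes T :: "'a::euclidean_space \<Rightarrow> 'a"
  assumes T: "orthogonal_transformation T"
  shows "distr lborel borel T = lborel"
proof (rule measure_eqI)
  show "sets (distr lborel borel T) = sets (lborel :: 'a measure)" by simp
next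
  fix A :: "'a set" assume "A \<in> sets (distr lborel borel T)"
  then have A[measurable]: "A \<in> sets borel" by simp
  have lin: "linear T" using T by (rule orthogonal_transformation_linear)
  have T_meas[measurable]: "T \<in> borel_measurable borel"
    using lin by (intro borel_measurable_continuous_onI linear_continuous_on) 
      (simp add: linear_conv_bounded_linear)
  let ?I = "\<lambda>S x. indicator S x :: ennreal"
  define B :: "'a set" where "B = ball 0 1"
  have B[measurable]: "B \<in> sets borel" by (simp add: B_def)
  have TB: "T x \<in> B \<longleftrightarrow> x \<in> B" for x
    using orthogonal_transformation_norm[OF T] by (simp add: B_def)
  then have TB': "?I B (T x) = ?I B x" for x by (simp add: indicator_def)
  have B0: "emeasure lborel B \<noteq> 0" "emeasure lborel B \<noteq> \<infinity>"
    using emeasure_lborel_ball_finite[of "0::'a" 1] content_ball_pos[of 1 "0::'a"]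
    by (auto simp: B_def measure_def)
  have "emeasure lborel (T -` A) * emeasure lborel B
      = (\<integral>\<^sup>+x. ?I A (T x) * (\<integral>\<^sup>+y. ?I B y \<partial>lborel) \<partial>lborel)"
  proof -
    have "T -` A \<in> sets borel" using measurable_sets[OF T_meas A] by simp
    moreover have "?I A (T x) = ?I (T -` A) x" for x by (simp add: indicator_def)
    ultimately show ?thesis by (simp add: nn_integral_multc)
  qed
  also have "\<dots> = (\<integral>\<^sup>+x. (\<integral>\<^sup>+y. ?I A (T x) * ?I B (y + T x) \<partial>lborel) \<partial>lborel)"
    by (simp add: nn_integral_cmult nn_integral_lborel_translate[where f="?I B"])
  also have "\<dots> = (\<integral>\<^sup>+y. (\<integral>\<^sup>+x. ?I A (T x) * ?I B (y + T x) \<partial>lborel) \<partial>lborel)"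
    by (rule lborel_pair.Fubini') measurable
  also have "\<dots> = (\<integral>\<^sup>+y. (\<integral>\<^sup>+x. ?I A (T x - y) * ?I B (T x) \<partial>lborel) \<partial>lborel)"
  proof (rule nn_integral_cong)
    fix y :: 'a
    obtain z where z: "T z = y" using orthogonal_transformation_surj[OF T] by (metis surjD)
    show "(\<integral>\<^sup>+x. ?I A (T x) * ?I B (y + T x) \<partial>lborel) = (\<integral>\<^sup>+x. ?I A (T x - y) * ?I B (T x) \<partial>lborel)"
      using nn_integral_lborel_translate[where f="\<lambda>x. ?I A (T x) * ?I B (y + T x)" and c = "- z"]
      by (simp add: linear_diff[OF lin] z)
  qed
  also have "\<dots> = (\<integral>\<^sup>+x. (\<integral>\<^sup>+y. ?I A (T x - y) * ?I B (T x) \<partial>lborel) \<partial>lborel)"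
    by (rule lborel_pair.Fubini') measurable
  also have "\<dots> = emeasure lborel A * emeasure lborel B"
    using TB' by (simp add: nn_integral_multc nn_integral_cmult nn_integral_lborel_reflect[where f="?I A"])
  finally show "emeasure (distr lborel borel T) A = emeasure lborel A"
    using B0 by (auto simp: emeasure_distr mult.commute[of _ "emeasure lborel B"] ennreal_mult_cancel_left)
qed

lemma space_sphere_measure [simp]: "space (sphere_measure :: (real^'n::finite) measure) = sphere 0 1"
  by (simp add: sphere_measure_def space_restrict_space)

lemma borel_measurable_sphere [measurable_dest]:
  "f \<in> borel_measurable borel \<Longrightarrow> f \<in> borel_measurable (sphere_measure :: (real^'n::finite) measure)"
  unfolding sphere_measure_def by (intro measurable_restrict_space1) simp

lemma emeasure_sphere_measure: "emeasure (sphere_measure :: (real^'n::finite) measure) (sphere 0 1) = 1"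
proof -
  let ?U = "uniform_measure lborel (ball (0::real^'n) 1)"
  have B0: "emeasure lborel (ball (0::real^'n) 1) \<noteq> 0" "emeasure lborel (ball (0::real^'n) 1) \<noteq> \<infinity>"
    using emeasure_lborel_ball_finite[of "0::real^'n" 1] content_ball_pos[of 1 "0::real^'n"]
    by (auto simp: measure_def)
  have eq: "(\<lambda>x::real^'n. x /\<^sub>R norm x) -` sphere 0 1 = - {0}"
    by (auto simp: field_simps)
  \<comment> \<open>Normalization sends everything except the origin, a null set, into the sphere.\<close>
  have "emeasure lborel (ball (0::real^'n) 1 \<inter> - {0}) = emeasure lborel (ball (0::real^'n) 1 - {0})"
    by (simp add: Diff_eq)
  also have "\<dots> = emeasure lborel (ball (0::real^'n) 1)"
    by (intro emeasure_Diff_null_set) auto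
  finally have "emeasure ?U (- {0}) = 1"
    using B0 by (simp add: ennreal_divide_self top.not_eq_extremum)
  then show ?thesis
    unfolding sphere_measure_def
    by (subst emeasure_restrict_space) (simp_all add: emeasure_distr eq)
qed

lemma finite_sphere_measure: "finite_measure (sphere_measure :: (real^'n::finite) measure)"
  by (rule finite_measureI) (simp add: emeasure_sphere_measure)

lemma sphere_integrable:
  fixes f :: "real^'n::finite \<Rightarrow> real"
  assumes "continuous_on UNIV f"
  shows "integrable sphere_measure f"
proof -
  have "bounded (f ` sphere 0 1)"
    using assms by (intro compact_imp_bounded compact_continuous_image) (auto intro: continuous_on_subset)
  then obtain B where "\<forall>x\<in>sphere 0 1. norm (f x) \<le> B" by (auto simp: bounded_iff)
  then show ?thesis
    using assms
    by (intro finite_measure.integrable_const_bound[OF finite_sphere_measure, of _ B])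
      (auto intro!: borel_measurable_sphere borel_measurable_continuous_onI AE_I2)
qed

lemma measure_sphere_measure [simp]: "measure (sphere_measure :: (real^'n::finite) measure) (sphere 0 1) = 1"
  by (simp add: measure_def emeasure_sphere_measure)

lemma sphere_integral_cong:
  fixes f g :: "real^'n::finite \<Rightarrow> real"
  assumes "\<And>u. norm u = 1 \<Longrightarrow> f u = g u"
  shows "(\<integral>u. f u \<partial>sphere_measure) = (\<integral>u. g u \<partial>sphere_measure)"
  using assms by (intro Bochner_Integration.integral_cong) auto

lemma sphere_integral_nonneg:
  fixes f :: "real^'n::finite \<Rightarrow> real"
  assumes "\<And>u. norm u = 1 \<Longrightarrow> 0 \<le> f u"
  shows "0 \<le> (\<integral>u. f u \<partial>sphere_measure)"
  using assms by (intro integral_nonneg_AE AE_I2) auto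

lemma sphere_integral_orthogonal:
  fixes f :: "real^'n::finite \<Rightarrow> real" and T :: "real^'n \<Rightarrow> real^'n"
  assumes T: "orthogonal_transformation T" and [measurable]: "f \<in> borel_measurable borel"
  shows "(\<integral>u. f (T u) \<partial>sphere_measure) = (\<integral>u. f u \<partial>sphere_measure)"
proof -
  have lin: "linear T" using T by (rule orthogonal_transformation_linear)
  have T_meas[measurable]: "T \<in> borel_measurable borel"
    using lin by (intro borel_measurable_continuous_onI linear_continuous_on) 
      (simp add: linear_conv_bounded_linear)
  let ?U = "uniform_measure lborel (ball (0::real^'n) 1)"
  have [measurable]: "sphere (0::real^'n) 1 \<in> sets borel" by simp
  let ?N = "\<lambda>x::real^'n. x /\<^sub>R norm x"
  have U: "distr ?U borel T = ?U"
  proof (rule measure_eqI)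
    fix A assume "A \<in> sets (distr ?U borel T)"
    then have A[measurable]: "A \<in> sets borel" by simp
    have [measurable]: "T -` A \<in> sets borel" using measurable_sets[OF T_meas A] by simp
    have "T -` (ball 0 1 \<inter> A) = ball 0 1 \<inter> T -` A"
      using orthogonal_transformation_norm[OF T] by auto
    then have "emeasure lborel (ball 0 1 \<inter> T -` A) = emeasure (distr lborel borel T) (ball 0 1 \<inter> A)"
      by (subst emeasure_distr) auto
    then show "emeasure (distr ?U borel T) A = emeasure ?U A"
      by (simp add: emeasure_distr lborel_distr_orthogonal[OF T])
  qed simp
  have NT: "?N (T x) = T (?N x)" for x
    using orthogonal_transformation_norm[OF T] by (simp add: linear_scale[OF lin])
  have sphere: "indicator (sphere 0 1) (T x) = (indicator (sphere 0 1) x :: real)" for x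
    using orthogonal_transformation_norm[OF T] by (simp add: indicator_def)
  have eq: "(\<integral>u. g u \<partial>sphere_measure) = (\<integral>x. indicator (sphere 0 1) (?N x) * g (?N x) \<partial>?U)"
    if [measurable]: "g \<in> borel_measurable borel" for g :: "real^'n \<Rightarrow> real"
    unfolding sphere_measure_def
    by (subst integral_restrict_space, simp, subst integral_distr) (simp_all, measurable)
  have "(\<integral>u. f u \<partial>sphere_measure) = (\<integral>x. indicator (sphere 0 1) (?N x) * f (?N x) \<partial>distr ?U borel T)"
    by (simp add: eq U)
  also have "\<dots> = (\<integral>x. indicator (sphere 0 1) (?N x) * f (T (?N x)) \<partial>?U)"
    by (subst integral_distr) (simp_all add: NT sphere del: indicator_simps)
  also have "\<dots> = (\<integral>u. f (T u) \<partial>sphere_measure)"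
    by (simp add: eq)
  finally show ?thesis ..
qed


section \<open>Gegenbauer polynomials\<close>

text \<open>The factor \<open>1 - x\<^sup>2\<close> of the weight. Carrying its powers inside the argument of a functional
  stands for a change of the exponent of the weight.\<close>

abbreviation x_poly :: "real poly" where "x_poly \<equiv> [:0, 1:]"
abbreviation weight_poly :: "real poly" where "weight_poly \<equiv> [:1, 0, -1:]"

lemma coeff_rodrigues_poly_above: "m > i \<Longrightarrow> coeff (rodrigues_poly a i) m = 0"
proof (induction i arbitrary: m)
  case (Suc i)
  then obtain m' where m: "m = Suc m'" "i < m'" by (cases m) auto
  with Suc.IH show ?case
    by (cases m') (auto simp: coeff_pderiv)
qed simp

lemma coeff_rodrigues_poly_top: "coeff (rodrigues_poly a i) i = (\<Prod>s<i. 2 * a - real s)"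
proof (induction i)
  case (Suc i)
  have "coeff ([:-1, 0, 1:] * pderiv R + [:0, c:] * R) (Suc i)
      = (real i + c) * coeff R i - real (Suc (Suc i)) * coeff R (Suc (Suc i))" for R c
    by (cases i) (simp_all add: coeff_pderiv algebra_simps)
  then show ?case
    unfolding rodrigues_poly.simps by (simp only: Suc.IH coeff_rodrigues_poly_above) simp
qed simp

lemma degree_rodrigues_poly: "degree (rodrigues_poly a i) \<le> i"
  by (rule degree_le) (auto simp: coeff_rodrigues_poly_above)

lemma poly_rodrigues_poly_1: "poly (rodrigues_poly a i) 1 = (\<Prod>s<i. 2 * (a - real s))"
  by (induction i) simp_all

text \<open>Differentiation exchanges even and odd polynomials, and so do the two terms of the recursion.\<close>

lemma rodrigues_poly_reflect:
  "pcompose (rodrigues_poly a i) [:0, -1:] = smult ((-1) ^ i) (rodrigues_poly a i)"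
proof (induction i)
  case (Suc i)
  have "pderiv (pcompose (rodrigues_poly a i) [:0, -1:]) = smult ((-1) ^ i) (pderiv (rodrigues_poly a i))"
    by (simp add: Suc.IH pderiv_smult)
  then have "- pcompose (pderiv (rodrigues_poly a i)) [:0, -1:] = smult ((-1) ^ i) (pderiv (rodrigues_poly a i))"
    by (simp add: pderiv_pcompose pderiv_pCons)
  then have *: "pcompose (pderiv (rodrigues_poly a i)) [:0, -1:] = - smult ((-1) ^ i) (pderiv (rodrigues_poly a i))"
    by (simp add: minus_equation_iff eq_commute)
  show ?case
    unfolding rodrigues_poly.simps pcompose_add pcompose_mult * Suc.IH
    by (simp add: pcompose_pCons smult_diff_right smult_add_right algebra_simps flip: smult_minus_left)
qed (simp add: pcompose_1)

lemma degree_legendre: "degree (legendre n m) \<le> m"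
  unfolding legendre_def using degree_rodrigues_poly degree_smult_le le_trans by blast

lemma legendre_reflect:
  "pcompose (legendre n m) [:0, -1:] = smult ((-1) ^ m) (legendre n m)"
  by (simp add: legendre_def pcompose_smult rodrigues_poly_reflect mult.commute)

lemma poly_legendre_1:
  assumes "n \<ge> 2"
  shows "poly (legendre n m) 1 = 1"
proof -
  have pos: "pochhammer ((real n - 1) / 2) m \<noteq> 0"
    using assms pochhammer_pos[of "(real n - 1) / 2" m] by simp
  have "(\<Prod>s<m. 2 * (real m + (real n - 3) / 2 - real s)) = 2 ^ m * (\<Prod>s<m. real m + (real n - 3) / 2 - real s)"
    by (simp only: prod.distrib prod_constant card_lessThan)
  also have "(\<Prod>s<m. real m + (real n - 3) / 2 - real s) = (\<Prod>s<m. (real n - 1) / 2 + real s)"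
    by (subst prod.nat_diff_reindex[symmetric])
      (auto intro!: prod.cong simp: of_nat_diff field_simps)
  also have "\<dots> = pochhammer ((real n - 1) / 2) m"
    by (simp add: pochhammer_prod atLeast0LessThan)
  finally show ?thesis
    using pos by (simp add: legendre_def poly_rodrigues_poly_1)
qed

lemma poly_legendre_minus_1:
  assumes "n \<ge> 2"
  shows "poly (legendre n m) (-1) = (-1) ^ m"
  using arg_cong[OF legendre_reflect[of n m], of "\<lambda>p. poly p 1"] poly_legendre_1[OF assms]
  by (simp add: poly_pcompose)

text \<open>The dimension of the harmonic forms of degree \<open>m\<close> in \<open>N + 2\<close> variables as a single quotient, the
  shape in which it appears as the inverse of a norm.\<close>

lemma harm_dim_eq:
  assumes "m \<ge> 1"
  shows "harm_dim (N + 2) m = (real N + 2 * real m) * fact (N + m - 1) / (fact m * fact N)"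
proof -
  obtain m' where m: "m = Suc m'" using assms by (cases m) auto
  have 1: "real ((N + 2 + m - 1) choose (N + 2 - 1)) = fact (N + m + 1) / (fact (N + 1) * fact m)"
    by (subst binomial_fact) auto
  have 2: "real ((N + 2 + m - 3) choose (N + 2 - 1)) = real m * (real m - 1) * fact (N + m - 1) / (fact (N + 1) * fact m)"
  proof (cases m')
    case (Suc k)
    then have "real ((N + 2 + m - 3) choose (N + 2 - 1)) = fact (N + m - 1) / (fact (N + 1) * fact k)"
      by (subst binomial_fact) (auto simp: m)
    moreover have "fact m = real m * (real m - 1) * fact k" "real m * (real m - 1) \<noteq> 0"
      by (simp_all add: m Suc)
    ultimately show ?thesis by simp
  qed (simp add: m)
  have 3: "fact (N + m + 1) = (real N + real m + 1) * (real N + real m) * fact (N + m - 1)"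
    by (simp add: m algebra_simps)
  have "harm_dim (N + 2) m = ((real N + real m + 1) * (real N + real m) - real m * (real m - 1)) * fact (N + m - 1) / (fact (N + 1) * fact m)"
    using assms unfolding harm_dim_def 1 2 3 by (simp add: diff_divide_distrib left_diff_distrib)
  also have "(real N + real m + 1) * (real N + real m) - real m * (real m - 1) = (real N + 1) * (real N + 2 * real m)"
    by (simp add: algebra_simps)
  also have "fact (N + 1) = (real N + 1) * fact N" by simp
  finally show ?thesis
    by simp
qed

lemma prod_falling_fact:
  assumes "i \<le> M"
  shows "(\<Prod>s<i. real M - real s) * fact (M - i) = fact M"
  using assms
proof (induction i)
  case (Suc i)
  then have "fact (M - i) = (real M - real i) * fact (M - Suc i)"
    by (metis Suc_diff_le Suc_le_lessD diff_Suc_Suc fact_Suc less_imp_le_nat of_nat_diff of_nat_fact of_nat_mult)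
  with Suc show ?case by (simp add: mult.assoc)
qed simp

text \<open>An algebraic stand-in for \<open>p \<mapsto> \<integral> p(x) (1 - x\<^sup>2)\<^bsup>(n-3)/2\<^esup> dx\<close>, normalized to total mass \<open>1\<close>: the last
  axiom is the integral of the derivative of \<open>p(x) (1 - x\<^sup>2)\<^bsup>(n-1)/2\<^esup>\<close>. Working from this axiom avoids the
  density of the distribution of a coordinate, which is unbounded for \<open>n = 2\<close>.\<close>

locale zonal_functional =
  fixes J :: "real poly \<Rightarrow> real" and n :: nat
  assumes n: "n \<ge> 2"
    and add: "J (p + q) = J p + J q"
    and smult: "J (smult c p) = c * J p"
    and one: "J 1 = 1"
    and parts: "J (weight_poly * pderiv p) = (real n - 1) * J (x_poly * p)"
begin

lemma zero: "J 0 = 0"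
  using smult[of 0 0] by simp

lemma minus: "J (- p) = - J p"
  using smult[of "-1" p] by simp

lemma diff: "J (p - q) = J p - J q"
  using add[of p "- q"] by (simp add: minus)

lemma sum: "J (\<Sum>i\<in>A. f i) = (\<Sum>i\<in>A. J (f i))"
  by (induction A rule: infinite_finite_induct) (simp_all add: zero add)

text \<open>Integration by parts for the weight with exponent \<open>(n - 3) / 2 + t\<close>.\<close>

lemma parts_power:
  "J (weight_poly ^ Suc t * pderiv p) = (real n - 1 + 2 * real t) * J (weight_poly ^ t * (x_poly * p))"
proof -
  have "weight_poly * pderiv (weight_poly ^ t * p)
      = weight_poly ^ Suc t * pderiv p - smult (2 * real t) (weight_poly ^ t * (x_poly * p))"
  proof (cases t)
    case (Suc s)
    have "pderiv (weight_poly ^ t) = smult (- (2 * real t)) (weight_poly ^ s * x_poly)"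
      by (simp only: Suc pderiv_power_Suc) (simp add: pderiv_pCons algebra_simps flip: smult_minus_left)
    then have "weight_poly * pderiv (weight_poly ^ t * p)
      = weight_poly ^ Suc t * pderiv p + smult (- (2 * real t)) (weight_poly ^ Suc s * (x_poly * p))"
      unfolding pderiv_mult by (simp only: power_Suc distrib_left mult_smult_right mult_smult_left ac_simps)
    then show ?thesis
      unfolding Suc by (simp only: smult_minus_left add_uminus_conv_diff)
  qed simp
  with parts[of "weight_poly ^ t * p"]
  have "J (weight_poly ^ Suc t * pderiv p) - 2 * real t * J (weight_poly ^ t * (x_poly * p))
      = (real n - 1) * J (x_poly * (weight_poly ^ t * p))"
    by (simp only: diff smult)
  moreover have "x_poly * (weight_poly ^ t * p) = weight_poly ^ t * (x_poly * p)"
    by (simp only: ac_simps)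
  ultimately show ?thesis by (simp add: algebra_simps)
qed

text \<open>Each step of the recursion of Rodrigues' formula is one integration by parts: it lowers the
  index of the Rodrigues polynomial, differentiates \<open>p\<close> and raises the exponent of the weight.\<close>

lemma rodrigues_parts:
  assumes "i \<le> m"
  defines "a \<equiv> real m + (real n - 3) / 2"
  shows "J (p * rodrigues_poly a m) = J (weight_poly ^ i * ((pderiv ^^ i) p * rodrigues_poly a (m - i)))"
  using assms(1)
proof (induction i)
  case (Suc i)
  define P R where "P = (pderiv ^^ i) p" and "R = rodrigues_poly a (m - Suc i)"
  have "m - i = Suc (m - Suc i)" using Suc.prems by simp
  moreover have "2 * (a - real (m - Suc i)) = real n - 1 + 2 * real i"
    using Suc.prems by (simp add: a_def of_nat_diff field_simps)
  ultimately have "rodrigues_poly a (m - i) = - (weight_poly * pderiv R) + smult (real n - 1 + 2 * real i) (x_poly * R)"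
    unfolding R_def by (simp only: rodrigues_poly.simps) simp
  then have "weight_poly ^ i * (P * rodrigues_poly a (m - i))
      = smult (real n - 1 + 2 * real i) (weight_poly ^ i * (x_poly * (P * R))) - weight_poly ^ Suc i * (P * pderiv R)"
    by (simp only: distrib_left mult_minus_right mult_smult_right power_Suc) (simp only: ac_simps add_uminus_conv_diff)
  then have "J (weight_poly ^ i * (P * rodrigues_poly a (m - i)))
      = J (weight_poly ^ Suc i * pderiv (P * R)) - J (weight_poly ^ Suc i * (P * pderiv R))"
    by (simp only: diff smult parts_power)
  also have "\<dots> = J (weight_poly ^ Suc i * (pderiv P * R))"
    by (simp only: pderiv_mult distrib_left add) (simp only: ac_simps add_diff_cancel_left' diff_add_eq)
  finally show ?case
    using Suc by (simp add: P_def R_def)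
qed simp

text \<open>Integration by parts with \<open>p = x\<close>, where \<open>x\<^sup>2 = 1 - (1 - x\<^sup>2)\<close>, gives a recursion of first order
  in \<open>t\<close>.\<close>

lemma weight_moment:
  "J (weight_poly ^ t) = pochhammer ((real n - 1) / 2) t / pochhammer (real n / 2) t"
proof (induction t)
  case (Suc t)
  have "weight_poly ^ t * (x_poly * x_poly) = weight_poly ^ t - weight_poly ^ Suc t"
  proof -
    have "x_poly * x_poly = 1 - weight_poly" by (simp add: one_pCons)
    then show ?thesis by (simp only: right_diff_distrib left_diff_distrib mult_1_left mult_1_right power_Suc ac_simps)
  qed
  with parts_power[of t x_poly]
  have "J (weight_poly ^ Suc t) = (real n - 1 + 2 * real t) * (J (weight_poly ^ t) - J (weight_poly ^ Suc t))"
    by (simp only: diff pderiv_pCons) simp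
  then have "J (weight_poly ^ Suc t) * (real n + 2 * real t) = (real n - 1 + 2 * real t) * J (weight_poly ^ t)"
    by (simp add: algebra_simps)
  moreover have "pochhammer (real n / 2) t > 0" using n by (intro pochhammer_pos) simp
  ultimately show ?case
    using n by (simp add: Suc.IH pochhammer_Suc divide_simps del: power_Suc) (simp add: algebra_simps del: power_Suc)
qed (simp add: one)

lemma legendre_orthogonal_lower:
  assumes "degree p < m"
  shows "J (p * legendre n m) = 0"
proof -
  have "(pderiv ^^ m) p = 0"
    using assms by (intro poly_eqI) (simp add: coeff_higher_pderiv coeff_eq_0)
  then show ?thesis
    using rodrigues_parts[of m m p] by (simp add: legendre_def smult zero)
qed

text \<open>By \<open>m\<close> integrations by parts, \<open>J(L\<^sub>m\<^sup>2)\<close> is the product of \<open>m!\<close>, the leading coefficient of the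
  Rodrigues polynomial, the moment \<open>J((1 - x\<^sup>2)\<^sup>m)\<close> and the square of the normalizing factor. The
  Pochhammer symbols combine by the duplication formula.\<close>

lemma legendre_norm: "harm_dim n m * J (legendre n m * legendre n m) = 1"
proof (cases "m = 0")
  case True
  then show ?thesis using one by (simp add: legendre_def harm_dim_def one_pCons)
next
  case False
  obtain N where N: "n = N + 2" using n by (metis le_add_diff_inverse2)
  define a where "a = real m + (real n - 3) / 2"
  define P Q where "P = pochhammer ((real N + 1) / 2) m" and "Q = pochhammer ((real N + 2) / 2) m"
  have nz: "P \<noteq> 0" "Q \<noteq> 0"
    unfolding P_def Q_def using pochhammer_pos[of "(real N + 1) / 2" m] pochhammer_pos[of "(real N + 2) / 2" m] by auto
  have lead: "coeff (rodrigues_poly a m) m = fact (2 * m + N - 1) / fact (m + N - 1)"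
  proof -
    have "coeff (rodrigues_poly a m) m = (\<Prod>s<m. real (2 * m + N - 1) - real s)"
      unfolding coeff_rodrigues_poly_top
      using False by (intro prod.cong) (auto simp: a_def N of_nat_diff field_simps)
    also have "\<dots> * fact (2 * m + N - 1 - m) = fact (2 * m + N - 1)"
      using False by (intro prod_falling_fact) simp
    moreover have "2 * m + N - 1 - m = m + N - 1" using False by simp
    ultimately show ?thesis by (simp add: field_simps)
  qed
  have "(pderiv ^^ m) (rodrigues_poly a m) = [:fact m * coeff (rodrigues_poly a m) m:]"
    by (intro poly_eqI)
      (auto simp: coeff_higher_pderiv coeff_pCons coeff_rodrigues_poly_above pochhammer_fact split: nat.splits)
  then have "J (rodrigues_poly a m * rodrigues_poly a m) = fact m * coeff (rodrigues_poly a m) m * J (weight_poly ^ m)"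
    using rodrigues_parts[of m m "rodrigues_poly a m"] by (simp add: a_def flip: smult)
  also have "J (weight_poly ^ m) = P / Q"
    by (simp add: weight_moment N P_def Q_def algebra_simps)
  finally have JR: "J (rodrigues_poly a m * rodrigues_poly a m) = fact m * (fact (2 * m + N - 1) / fact (m + N - 1)) * (P / Q)"
    by (simp add: lead)
  have "J (legendre n m * legendre n m) = (1 / (2 ^ m * P))\<^sup>2 * J (rodrigues_poly a m * rodrigues_poly a m)"
  proof -
    have *: "(real n - 1) / 2 = (real N + 1) / 2" by (simp add: N)
    show ?thesis
      unfolding legendre_def * P_def[symmetric] a_def[symmetric] by (simp add: smult power2_eq_square)
  qed
  also have "\<dots> = fact m * fact (2 * m + N - 1) / (fact (m + N - 1) * (4 ^ m * P * Q))"
    using nz by (simp add: JR field_simps power2_eq_square flip: power_mult_distrib)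
  also have "4 ^ m * P * Q = pochhammer (real N + 1) (2 * m)"
    using pochhammer_double[of "(real N + 1) / 2" m] by (simp add: P_def Q_def power_mult add_divide_distrib add.commute)
  also have "\<dots> = fact (N + 2 * m) / fact N"
    using pochhammer_product[of N "N + 2 * m" "1::real"]
    by (simp add: add.commute nonzero_eq_divide_eq flip: pochhammer_fact)
  also have "fact (N + 2 * m) = (real N + 2 * real m) * fact (2 * m + N - 1)"
    using False by (subst fact_reduce) (auto simp: add.commute)
  finally have JL: "J (legendre n m * legendre n m) = fact m * fact (2 * m + N - 1)
      / (fact (m + N - 1) * ((real N + 2 * real m) * fact (2 * m + N - 1) / fact N))" .
  have h: "harm_dim n m = (real N + 2 * real m) * fact (m + N - 1) / (fact m * fact N)"
    using False harm_dim_eq[of m N] by (simp only: N add.commute[of N m])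
  have "real N + 2 * real m > 0" using False by simp
  then show ?thesis
    unfolding JL h by simp
qed

text \<open>The polynomials \<open>L\<^sub>m\<close> with \<open>m \<le> 2d\<close> span the polynomials of degree at most \<open>2d\<close>. On \<open>L\<^sub>m\<close> the left
  side is \<open>h\<^sub>m J(L\<^sub>m\<^sup>2) = 1\<close> or \<open>0\<close> according to the parity of \<open>m\<close>, because only even indices occur in \<open>q\<close>;
  the right side has the same values by \<open>L\<^sub>m(1) = 1\<close> and \<open>L\<^sub>m(-1) = (-1)\<^sup>m\<close>. The free coefficients of
  \<open>q\<close> are invisible to polynomials of degree at most \<open>2d\<close>.\<close>

theorem kernel_reproducing:
  assumes q: "q \<in> kernel_polys n d k" and r: "degree r \<le> 2 * d"
  shows "J (r * q) = (poly r 1 + poly r (-1)) / 2"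
proof -
  obtain b where qb: "q = (\<Sum>j=0..d. smult (harm_dim n (2 * j)) (legendre n (2 * j)))
       + (\<Sum>j=d+1..k. smult (b j) (legendre n (2 * j)))"
    using q by (auto simp: kernel_polys_def)
  have expand: "J (p * q) = (\<Sum>j=0..d. harm_dim n (2 * j) * J (p * legendre n (2 * j)))"
    if "degree p \<le> 2 * d" for p
  proof -
    have "J (p * legendre n (2 * j)) = 0" if "j \<in> {d+1..k}" for j
      using that \<open>degree p \<le> 2 * d\<close> by (intro legendre_orthogonal_lower) auto
    then show ?thesis
      by (simp add: qb distrib_left sum_distrib_left add sum smult)
  qed
  have basis: "J (legendre n m * q) = (poly (legendre n m) 1 + poly (legendre n m) (-1)) / 2"
    if "m \<le> 2 * d" for m
  proof -
    have orth: "harm_dim n (2 * j) * J (legendre n m * legendre n (2 * j)) = (if m = 2 * j then 1 else 0)" for j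
    proof (cases m "2 * j" rule: linorder_cases)
      case less
      then have "J (legendre n m * legendre n (2 * j)) = 0"
        using degree_legendre[of n m] by (intro legendre_orthogonal_lower) auto
      with less show ?thesis by simp
    next
      case greater
      then have "J (legendre n (2 * j) * legendre n m) = 0"
        using degree_legendre[of n "2 * j"] by (intro legendre_orthogonal_lower) auto
      with greater show ?thesis by (simp add: mult.commute)
    qed (simp add: legendre_norm)
    have "J (legendre n m * q) = (\<Sum>j=0..d. if m = 2 * j then 1 else 0)"
      using expand[of "legendre n m"] degree_legendre[of n m] that by (simp add: orth)
    also have "\<dots> = (if even m then 1 else 0)"
    proof (cases "even m")
      case True
      then obtain j where "m = 2 * j" by (elim evenE)
      then show ?thesis using that by simp
    qed (auto intro!: sum.neutral)
    finally show ?thesis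
      by (simp add: poly_legendre_1[OF n] poly_legendre_minus_1[OF n])
  qed
  have "J (p * q) = (poly p 1 + poly p (-1)) / 2" if "degree p < N" "N \<le> 2 * d + 1" for p N
    using that
  proof (induction N arbitrary: p)
    case (Suc N)
    define l where "l = coeff (legendre n N) N"
    define c where "c = coeff p N / l"
    have "coeff (rodrigues_poly (real N + (real n - 3) / 2) N) N > 0"
      using n unfolding coeff_rodrigues_poly_top by (intro prod_pos) (auto simp: field_simps)
    moreover have "pochhammer ((real n - 1) / 2) N > 0"
      using n by (intro pochhammer_pos) simp
    ultimately have l: "l \<noteq> 0" by (simp add: l_def legendre_def)
    define s where "s = p - smult c (legendre n N)"
    have s: "J (s * q) = (poly s 1 + poly s (-1)) / 2"
    proof (cases "s = 0")
      case False
      have "coeff s i = 0" if "i \<ge> N" for i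
      proof (cases "i = N")
        case True
        then show ?thesis using l by (simp add: s_def c_def l_def)
      next
        case False
        then have "coeff p i = 0" "coeff (legendre n N) i = 0"
          using that Suc.prems degree_legendre[of n N] by (auto intro!: coeff_eq_0)
        then show ?thesis by (simp add: s_def)
      qed
      then have "degree s < N"
        using False by (meson leading_coeff_0_iff not_le)
      then show ?thesis using Suc by simp
    qed (simp add: zero)
    have p: "p = s + smult c (legendre n N)" by (simp add: s_def)
    have "J (p * q) = J (s * q) + c * J (legendre n N * q)"
      unfolding p by (simp add: distrib_right add smult)
    also have "\<dots> = (poly p 1 + poly p (-1)) / 2"
      using Suc.prems basis[of N] unfolding p by (simp add: s add_divide_distrib distrib_left)
    finally show ?case .
  qed simp
  from this[of r "2 * d + 1"] r show ?thesis by simp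
qed

end


section \<open>Integration by parts on the sphere\<close>

definition plane_rotation :: "'n \<Rightarrow> 'n \<Rightarrow> real \<Rightarrow> real^'n \<Rightarrow> real^'n::finite" where
  "plane_rotation i j t u = (\<chi> m. if m = i then cos t * u $ i - sin t * u $ j
     else if m = j then sin t * u $ i + cos t * u $ j else u $ m)"

lemma orthogonal_plane_rotation:
  assumes "i \<noteq> j"
  shows "orthogonal_transformation (plane_rotation i j t :: real^'n::finite \<Rightarrow> real^'n)"
  unfolding orthogonal_transformation_def
proof (intro conjI allI)
  show "linear (plane_rotation i j t :: real^'n \<Rightarrow> real^'n)"
    by (rule linearI) (simp_all add: plane_rotation_def vec_eq_iff algebra_simps)
next
  fix v w :: "real^'n"
  let ?T = "plane_rotation i j t"
  have split: "(\<Sum>m\<in>UNIV. f m) = f i + (f j + (\<Sum>m\<in>UNIV - {i} - {j}. f m))" for f :: "'n \<Rightarrow> real"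
    using assms by (subst sum.remove[of _ i], simp, simp) (subst sum.remove[of _ j], auto)
  have "(cos t * v $ i - sin t * v $ j) * (cos t * w $ i - sin t * w $ j)
      + (sin t * v $ i + cos t * v $ j) * (sin t * w $ i + cos t * w $ j)
      = (cos t * cos t + sin t * sin t) * (v $ i * w $ i + v $ j * w $ j)"
    by algebra
  also have "cos t * cos t + sin t * sin t = 1"
    using sin_cos_squared_add[of t] by (simp add: power2_eq_square)
  finally show "?T v \<bullet> ?T w = v \<bullet> w"
    using assms by (simp add: inner_vec_def split plane_rotation_def)
qed

text \<open>The integral of \<open>p(u\<^sub>i) r(u\<^sub>j) H(u)\<close> does not change under a rotation by the angle \<open>t\<close> in the plane
  of the coordinates \<open>i\<close> and \<open>j\<close>. Its derivative at \<open>t = 0\<close>, taken under the integral by dominated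
  convergence, is the difference of the two sides.\<close>

lemma sphere_integral_rotation:
  fixes p r :: "real poly" and H :: "real^'n::finite \<Rightarrow> real"
  assumes ij: "i \<noteq> j" and H: "continuous_on UNIV H"
    and inv: "\<And>u v. (\<And>m. m \<noteq> i \<Longrightarrow> m \<noteq> j \<Longrightarrow> u $ m = v $ m) \<Longrightarrow> H u = H v"
  shows "(\<integral>u. u $ i * poly p (u $ i) * poly (pderiv r) (u $ j) * H u \<partial>sphere_measure)
       = (\<integral>u. u $ j * poly (pderiv p) (u $ i) * poly r (u $ j) * H u \<partial>sphere_measure)"
proof -
  define g where "g t u = poly p (cos t * u $ i - sin t * u $ j) * poly r (sin t * u $ i + cos t * u $ j) * H u" for t and u :: "real^'n"
  define g' where "g' t u = (- (sin t * u $ i + cos t * u $ j) * poly (pderiv p) (cos t * u $ i - sin t * u $ j) * poly r (sin t * u $ i + cos t * u $ j)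
      + (cos t * u $ i - sin t * u $ j) * poly p (cos t * u $ i - sin t * u $ j) * poly (pderiv r) (sin t * u $ i + cos t * u $ j)) * H u" for t and u :: "real^'n"
  have deriv: "((\<lambda>t. g t u) has_real_derivative g' t u) (at t)" for t u
    unfolding g_def g'_def by (auto intro!: derivative_eq_intros simp: algebra_simps)
  have gc: "continuous_on UNIV (g t)" for t
    unfolding g_def by (intro continuous_intros H)
  have gi: "integrable sphere_measure (g t)" for t
    by (intro sphere_integrable gc)
  have const: "(\<integral>u. g t u \<partial>sphere_measure) = (\<integral>u. g 0 u \<partial>sphere_measure)" for t
  proof -
    have "g 0 (plane_rotation i j t u) = g t u" for u
      using ij inv[of "plane_rotation i j t u" u] by (simp add: g_def plane_rotation_def)
    then show ?thesis
      using sphere_integral_orthogonal[OF orthogonal_plane_rotation[OF ij], of "g 0" t] gc[of 0]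
      by (simp add: borel_measurable_continuous_onI)
  qed
  have "continuous_on UNIV (\<lambda>z. g' (fst z) (snd z))"
    unfolding g'_def by (intro continuous_intros continuous_on_compose2[OF H]) auto
  then have "bounded ((\<lambda>z. g' (fst z) (snd z)) ` ({0..1} \<times> sphere 0 1))"
    by (intro compact_imp_bounded compact_continuous_image compact_Times)
      (auto intro: continuous_on_subset)
  then obtain B where B: "\<And>t u. t \<in> {0..1} \<Longrightarrow> norm u = 1 \<Longrightarrow> \<bar>g' t u\<bar> \<le> B"
    unfolding bounded_iff by fastforce
  define s where "s k = inverse (real (Suc k))" for k
  have s: "0 < s k" "s k \<le> 1" "s \<longlonglongrightarrow> 0" for k
    using LIMSEQ_inverse_real_of_nat by (auto simp: s_def[abs_def] inverse_le_1_iff)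
  \<comment> \<open>Difference quotients along \<open>s k\<close>; the mean value theorem bounds them uniformly on the sphere.\<close>
  define D where "D k u = (g (s k) u - g 0 u) / s k" for k and u :: "real^'n"
  have "(\<lambda>k. \<integral>u. D k u \<partial>sphere_measure) \<longlonglongrightarrow> (\<integral>u. g' 0 u \<partial>sphere_measure)"
  proof (rule integral_dominated_convergence)
    show "(\<lambda>u. g' 0 u) \<in> borel_measurable (sphere_measure :: (real^'n) measure)"
      unfolding g'_def by (intro borel_measurable_sphere borel_measurable_continuous_onI continuous_intros H)
    show "(\<lambda>u. D k u) \<in> borel_measurable (sphere_measure :: (real^'n) measure)" for k
      unfolding D_def by (intro borel_measurable_sphere borel_measurable_continuous_onI continuous_intros gc) 
        (use s(1)[of k] in auto)
    show "integrable (sphere_measure :: (real^'n) measure) (\<lambda>_. B)"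
      by (intro sphere_integrable continuous_intros)
    have "(\<lambda>k. D k u) \<longlonglongrightarrow> g' 0 u" for u
    proof -
      have "((\<lambda>h. (g (0 + h) u - g 0 u) / h) \<longlongrightarrow> g' 0 u) (at 0)"
        using deriv[of u 0] unfolding DERIV_def .
      moreover have "filterlim s (at 0) sequentially"
        using s by (auto simp: filterlim_at intro!: always_eventually) (metis less_irrefl)
      ultimately show ?thesis
        unfolding D_def by (auto dest: filterlim_compose)
    qed
    then show "AE u in sphere_measure. (\<lambda>k. D k u) \<longlonglongrightarrow> g' 0 u" by simp
    show "AE u in (sphere_measure :: (real^'n) measure). norm (D k u) \<le> B" for k
    proof (rule AE_I2)
      fix u :: "real^'n" assume "u \<in> space sphere_measure"
      then have u: "norm u = 1" by simp
      obtain z where z: "0 < z" "z < s k" "g (s k) u - g 0 u = (s k - 0) * g' z u"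
        using MVT2[OF s(1)[of k], of "\<lambda>t. g t u" "\<lambda>t. g' t u"] deriv by blast
      then have "D k u = g' z u" using s(1)[of k] by (simp add: D_def)
      moreover have "z \<in> {0..1}" using z s(2)[of k] by auto
      ultimately show "norm (D k u) \<le> B" using B u by simp
    qed
  qed
  moreover have "(\<integral>u. D k u \<partial>sphere_measure) = 0" for k
    unfolding D_def by (simp add: Bochner_Integration.integral_diff[OF gi gi] const[of "s k"])
  ultimately have "(\<integral>u. g' 0 u \<partial>sphere_measure) = 0"
    using LIMSEQ_unique[OF _ tendsto_const] by fastforce
  moreover have "(\<integral>u. g' 0 u \<partial>sphere_measure)
      = (\<integral>u. u $ i * poly p (u $ i) * poly (pderiv r) (u $ j) * H u - u $ j * poly (pderiv p) (u $ i) * poly r (u $ j) * H u \<partial>sphere_measure)"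
    by (simp add: g'_def algebra_simps)
  ultimately show ?thesis
    by (subst (asm) Bochner_Integration.integral_diff) (auto intro!: sphere_integrable continuous_intros H)
qed


section \<open>Integrating monomials against zonal functions\<close>

definition monomial :: "('n::finite \<Rightarrow> nat) \<Rightarrow> real^'n \<Rightarrow> real" where
  "monomial e u = (\<Prod>i\<in>UNIV. (u $ i) ^ e i)"

lemma continuous_on_monomial [continuous_intros]: "continuous_on A (monomial e)"
  unfolding monomial_def by (intro continuous_intros)

definition zonal_integral :: "'n::finite \<Rightarrow> real poly \<Rightarrow> real" where
  "zonal_integral a p = (\<integral>u. poly p ((u :: real^'n) $ a) \<partial>sphere_measure)"

lemma sphere_coordinate:
  fixes u :: "real^'n::finite"
  assumes "norm u = 1"
  shows "(\<Sum>l\<in>UNIV - {a}. (u $ l)\<^sup>2) = 1 - (u $ a)\<^sup>2"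
proof -
  have "1 = (\<Sum>l\<in>UNIV. (u $ l)\<^sup>2)"
    using assms by (simp add: norm_eq_1 inner_vec_def power2_eq_square)
  also have "\<dots> = (u $ a)\<^sup>2 + (\<Sum>l\<in>UNIV - {a}. (u $ l)\<^sup>2)"
    by (simp add: sum.remove)
  finally show ?thesis by simp
qed

lemma sphere_integral_sum_squares:
  fixes F :: "real^'n::finite \<Rightarrow> real"
  assumes "continuous_on UNIV F"
  shows "(\<Sum>l\<in>UNIV - {a}. \<integral>u. (u $ l)\<^sup>2 * F u \<partial>sphere_measure) = (\<integral>u. poly weight_poly (u $ a) * F u \<partial>sphere_measure)"
proof -
  have "(\<Sum>l\<in>UNIV - {a}. \<integral>u. (u $ l)\<^sup>2 * F u \<partial>sphere_measure) = (\<integral>u. (\<Sum>l\<in>UNIV - {a}. (u $ l)\<^sup>2) * F u \<partial>sphere_measure)"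
    unfolding sum_distrib_right
    by (intro Bochner_Integration.integral_sum[symmetric] sphere_integrable continuous_intros assms)
  also have "\<dots> = (\<integral>u. poly weight_poly (u $ a) * F u \<partial>sphere_measure)"
    by (intro sphere_integral_cong) (simp add: sphere_coordinate, simp add: power2_eq_square)
  finally show ?thesis .
qed

text \<open>The rotation identity for \<open>p = x\<^bsup>e j + 1\<^esup>\<close> and \<open>r = x\<^bsup>e l + 1\<^esup>\<close>; a function of \<open>u\<^sub>a\<close> is constant under
  the rotations used.\<close>

lemma monomial_exchange:
  fixes e :: "'n::finite \<Rightarrow> nat"
  assumes "j \<noteq> l" "j \<noteq> a" "l \<noteq> a"
  shows "(real (e l) + 1) * (\<integral>u. (u $ j)\<^sup>2 * (monomial e u * poly P (u $ a)) \<partial>sphere_measure)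
       = (real (e j) + 1) * (\<integral>u. (u $ l)\<^sup>2 * (monomial e u * poly P (u $ a)) \<partial>sphere_measure)"
proof -
  define H where "H u = (\<Prod>m\<in>UNIV - {j} - {l}. (u $ m) ^ e m) * poly P (u $ a)" for u :: "real^'n"
  have split: "monomial e u * poly P (u $ a) = (u $ j) ^ e j * ((u $ l) ^ e l * H u)" for u
    using assms unfolding monomial_def H_def
    by (subst prod.remove[of _ j], simp, simp) (subst prod.remove[of _ l], auto)
  have "(\<integral>u. u $ j * poly (monom 1 (Suc (e j))) (u $ j) * poly (pderiv (monom 1 (Suc (e l)))) (u $ l) * H u \<partial>sphere_measure)
      = (\<integral>u. u $ l * poly (pderiv (monom 1 (Suc (e j)))) (u $ j) * poly (monom 1 (Suc (e l))) (u $ l) * H u \<partial>sphere_measure)"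
    using assms by (intro sphere_integral_rotation)
      (auto simp: H_def intro!: continuous_intros prod.cong arg_cong2[of _ _ _ _ "(*)"])
  then show ?thesis
    unfolding split Bochner_Integration.integral_mult_right_zero[symmetric]
    by (simp add: pderiv_monom poly_monom power2_eq_square algebra_simps)
qed

text \<open>By the exchange rule the integrals of \<open>u\<^sub>l\<^sup>2 W P(u\<^sub>a)\<close>, for \<open>W\<close> the monomial, are proportional to
  \<open>e l + 1\<close> as \<open>l \<noteq> a\<close> varies, and their sum is known because \<open>u\<^sub>l\<^sup>2\<close> sums to \<open>1 - u\<^sub>a\<^sup>2\<close>.\<close>

lemma monomial_reduce:
  fixes e :: "'n::finite \<Rightarrow> nat"
  assumes "j \<noteq> a"
  shows "(\<Sum>l\<in>UNIV - {a}. real (e l) + 1) * (\<integral>u. (u $ j)\<^sup>2 * (monomial e u * poly P (u $ a)) \<partial>sphere_measure)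
       = (real (e j) + 1) * (\<integral>u. monomial e u * poly (weight_poly * P) (u $ a) \<partial>sphere_measure)"
proof -
  let ?E = "\<lambda>l. \<integral>u. (u $ l)\<^sup>2 * (monomial e u * poly P (u $ a)) \<partial>sphere_measure"
  have "(\<Sum>l\<in>UNIV - {a}. real (e l) + 1) * ?E j = (\<Sum>l\<in>UNIV - {a}. (real (e j) + 1) * ?E l)"
    unfolding sum_distrib_right
  proof (rule sum.cong)
    fix l assume "l \<in> UNIV - {a}"
    then show "(real (e l) + 1) * ?E j = (real (e j) + 1) * ?E l"
      using assms monomial_exchange[of j l a e P] by (cases "j = l") auto
  qed simp
  also have "\<dots> = (real (e j) + 1) * (\<integral>u. poly weight_poly (u $ a) * (monomial e u * poly P (u $ a)) \<partial>sphere_measure)"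
    by (subst sphere_integral_sum_squares[symmetric]) (auto intro!: continuous_intros simp: sum_distrib_left)
  finally show ?thesis by (simp only: poly_mult ac_simps)
qed

text \<open>Reflect the coordinate \<open>j\<close>.\<close>

lemma monomial_odd:
  fixes e :: "'n::finite \<Rightarrow> nat"
  assumes "j \<noteq> a" "odd (e j)"
  shows "(\<integral>u. monomial e u * poly P (u $ a) \<partial>sphere_measure) = 0"
proof -
  define T :: "real^'n \<Rightarrow> real^'n" where "T u = (\<chi> m. if m = j then - (u $ m) else u $ m)" for u
  have "orthogonal_transformation T"
    unfolding orthogonal_transformation_def T_def
    by (auto intro!: linearI sum.cong simp: vec_eq_iff inner_vec_def)
  then have "(\<integral>u. monomial e (T u) * poly P (T u $ a) \<partial>sphere_measure) = (\<integral>u. monomial e u * poly P (u $ a) \<partial>sphere_measure)"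
    by (rule sphere_integral_orthogonal) (intro borel_measurable_continuous_onI continuous_intros)
  moreover have "monomial e (T u) = - monomial e u" for u
  proof -
    have "monomial e (T u) = (- (u $ j)) ^ e j * (\<Prod>i\<in>UNIV - {j}. (u $ i) ^ e i)"
      unfolding monomial_def by (subst prod.remove[of _ j]) (auto simp: T_def)
    also have "\<dots> = - monomial e u"
      unfolding monomial_def using assms by (subst (2) prod.remove[of _ j]) auto
    finally show ?thesis .
  qed
  moreover have "T u $ a = u $ a" for u using assms by (simp add: T_def)
  ultimately show ?thesis by simp
qed

text \<open>A monomial in the coordinates other than \<open>a\<close> integrates like a constant times a power of
  \<open>1 - u\<^sub>a\<^sup>2\<close>. That \<open>C\<close> is independent of \<open>P\<close> is the point: it makes the induction go through, where the
  reduction step multiplies \<open>P\<close> by \<open>1 - x\<^sup>2\<close>. If some exponent is odd then \<open>C = 0\<close>, so the rounding in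
  the exponent is harmless.\<close>

lemma monomial_zonal:
  fixes e :: "'n::finite \<Rightarrow> nat"
  assumes "e a = 0"
  shows "\<exists>C. \<forall>P. (\<integral>u. monomial e u * poly P (u $ a) \<partial>sphere_measure)
            = C * zonal_integral a (weight_poly ^ ((\<Sum>i\<in>UNIV. e i) div 2) * P)"
  using assms
proof (induction "\<Sum>i\<in>UNIV. e i" arbitrary: e rule: less_induct)
  case less
  show ?case
  proof (cases "\<exists>j. e j \<noteq> 0")
    case False
    then show ?thesis by (intro exI[of _ 1]) (simp add: monomial_def zonal_integral_def)
  next
    case True
    then obtain j where j: "e j \<noteq> 0" by auto
    with less.prems have ja: "j \<noteq> a" by auto
    show ?thesis
    proof (cases "odd (e j)")
      case True
      with ja show ?thesis by (intro exI[of _ 0]) (simp add: monomial_odd)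
    next
      case False
      with j have ej: "e j = Suc (Suc (e j - 2))" by presburger
      define e' where "e' = e(j := e j - 2)"
      have split: "(\<Sum>i\<in>UNIV. f i) = f j + (\<Sum>i\<in>UNIV - {j}. f i)" for f :: "'n \<Rightarrow> nat"
        by (simp add: sum.remove)
      have deg: "(\<Sum>i\<in>UNIV. e i) = Suc (Suc (\<Sum>i\<in>UNIV. e' i))"
        unfolding split e'_def using ej by simp
      have mono: "monomial e u = (u $ j)\<^sup>2 * monomial e' u" for u
      proof -
        have "monomial e' u = (u $ j) ^ (e j - 2) * (\<Prod>i\<in>UNIV - {j}. (u $ i) ^ e i)"
          unfolding monomial_def by (subst prod.remove[of _ j]) (auto simp: e'_def)
        moreover have "monomial e u = (u $ j) ^ e j * (\<Prod>i\<in>UNIV - {j}. (u $ i) ^ e i)"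
          unfolding monomial_def by (subst prod.remove[of _ j]) auto
        ultimately show ?thesis
          by (subst (asm) (2) ej) (simp add: power2_eq_square mult.assoc)
      qed
      obtain C where C: "\<And>P. (\<integral>u. monomial e' u * poly P (u $ a) \<partial>sphere_measure)
            = C * zonal_integral a (weight_poly ^ ((\<Sum>i\<in>UNIV. e' i) div 2) * P)"
        using less.hyps[of e'] less.prems deg ja by (auto simp: e'_def)
      define S where "S = (\<Sum>l\<in>UNIV - {a}. real (e' l) + 1)"
      have "S > 0" unfolding S_def using ja by (intro sum_pos) auto
      have "(\<integral>u. monomial e u * poly P (u $ a) \<partial>sphere_measure)
          = ((real (e' j) + 1) * C / S) * zonal_integral a (weight_poly ^ ((\<Sum>i\<in>UNIV. e i) div 2) * P)" for P
      proof -
        have "S * (\<integral>u. monomial e u * poly P (u $ a) \<partial>sphere_measure)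
          = (real (e' j) + 1) * (\<integral>u. monomial e' u * poly (weight_poly * P) (u $ a) \<partial>sphere_measure)"
          using monomial_reduce[OF ja, of e' P] by (simp only: mono S_def mult.assoc)
        also have "\<dots> = (real (e' j) + 1) * C * zonal_integral a (weight_poly ^ ((\<Sum>i\<in>UNIV. e' i) div 2) * (weight_poly * P))"
          by (simp only: C mult.assoc)
        also have "weight_poly ^ ((\<Sum>i\<in>UNIV. e' i) div 2) * (weight_poly * P) = weight_poly ^ ((\<Sum>i\<in>UNIV. e i) div 2) * P"
          by (simp only: deg div2_Suc_Suc power_Suc ac_simps)
        finally show ?thesis using \<open>S > 0\<close> by (simp add: field_simps)
      qed
      then show ?thesis by blast
    qed
  qed
qed

text \<open>The axiom on integration by parts is the sum over \<open>l \<noteq> a\<close> of the rotation identities in the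
  planes of \<open>a\<close> and \<open>l\<close>, with \<open>r = x\<close>.\<close>

lemma zonal_integral_functional:
  fixes a :: "'n::finite"
  assumes "CARD('n) \<ge> 2"
  shows "zonal_functional (zonal_integral a) CARD('n)"
proof
  show "zonal_integral a (p + q) = zonal_integral a p + zonal_integral a q" for p q
    unfolding zonal_integral_def poly_add
    by (intro Bochner_Integration.integral_add sphere_integrable continuous_intros)
  show "zonal_integral a (smult c p) = c * zonal_integral a p" for c p
    by (simp add: zonal_integral_def)
  show "zonal_integral a 1 = 1"
    by (simp add: zonal_integral_def)
  show "zonal_integral a (weight_poly * pderiv p) = (real CARD('n) - 1) * zonal_integral a (x_poly * p)" for p
  proof -
    have "zonal_integral a (x_poly * p) = (\<integral>u. (u $ l)\<^sup>2 * poly (pderiv p) (u $ a) \<partial>sphere_measure)"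
      if "l \<in> UNIV - {a}" for l
      using that sphere_integral_rotation[of a l "\<lambda>_. 1" p x_poly]
      by (simp add: zonal_integral_def pderiv_pCons power2_eq_square mult_ac)
    then have "(\<Sum>l\<in>UNIV - {a}. \<integral>u. (u $ l)\<^sup>2 * poly (pderiv p) (u $ a) \<partial>sphere_measure)
        = (\<Sum>l\<in>UNIV - {a}. zonal_integral a (x_poly * p))"
      by simp
    also have "\<dots> = (real CARD('n) - 1) * zonal_integral a (x_poly * p)"
      using assms by (simp add: of_nat_diff)
    finally show ?thesis
      by (subst (asm) sphere_integral_sum_squares) (auto intro!: continuous_intros simp: zonal_integral_def algebra_simps)
  qed
qed (fact assms)

lemma kernel_polys_1: "q \<in> kernel_polys 1 d k \<Longrightarrow> q = 1"
proof -
  assume "q \<in> kernel_polys 1 d k"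
  then obtain b where q: "q = (\<Sum>j=0..d. smult (harm_dim 1 (2 * j)) (legendre 1 (2 * j)))
       + (\<Sum>j=d+1..k. smult (b j) (legendre 1 (2 * j)))"
    by (auto simp: kernel_polys_def)
  have L: "legendre 1 (2 * j) = (if j = 0 then 1 else 0)" for j
    by (auto simp: legendre_def pochhammer_0_left)
  have "(\<Sum>j=d+1..k. smult (b j) (legendre 1 (2 * j))) = 0"
    by (intro sum.neutral) (simp add: L del: One_nat_def)
  moreover have "(\<Sum>j=0..d. smult (harm_dim 1 (2 * j)) (legendre 1 (2 * j))) = 1"
    by (subst sum.remove[of _ 0]) (auto simp: L harm_dim_def legendre_def[of _ 0] intro!: sum.neutral)
  ultimately show "q = 1" by (simp add: q)
qed

text \<open>In one variable the kernel is \<open>1\<close> and the sphere consists of the points \<open>\<plusminus>1\<close>, each of mass one half,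
  so the formula also holds there.\<close>

lemma zonal_kernel:
  fixes a :: "'n::finite"
  assumes q: "q \<in> kernel_polys CARD('n) d k" and r: "degree r \<le> 2 * d"
  shows "zonal_integral a (r * q) = (poly r 1 + poly r (-1)) / 2"
proof (cases "CARD('n) \<ge> 2")
  case True
  then show ?thesis
    using zonal_functional.kernel_reproducing[OF zonal_integral_functional q r] by blast
next
  case False
  moreover have "CARD('n) > 0" by simp
  ultimately have card: "CARD('n) = 1" by linarith
  then have q1: "q = 1" using q kernel_polys_1 by simp
  have univ: "UNIV - {a} = {}"
    using card by (metis UNIV_I Diff_cancel card_1_singletonE singletonD)
  have refl: "zonal_integral a r = (\<integral>u. poly r (- (u $ a)) \<partial>(sphere_measure :: (real^'n) measure))"
    using sphere_integral_orthogonal[of uminus "\<lambda>u::real^'n. poly r (u $ a)"]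
    by (simp add: zonal_integral_def orthogonal_transformation_neg borel_measurable_continuous_onI continuous_intros)
  have "zonal_integral a r + zonal_integral a r
      = (\<integral>u. poly r (u $ a) + poly r (- (u $ a)) \<partial>(sphere_measure :: (real^'n) measure))"
    by (subst (2) refl, unfold zonal_integral_def)
      (intro Bochner_Integration.integral_add[symmetric] sphere_integrable continuous_intros)
  also have "\<dots> = (\<integral>u. poly r 1 + poly r (-1) \<partial>(sphere_measure :: (real^'n) measure))"
  proof (rule sphere_integral_cong)
    fix u :: "real^'n" assume "norm u = 1"
    then have "(u $ a)\<^sup>2 = 1"
      using sphere_coordinate[of u a] univ by simp
    then have "u $ a = 1 \<or> u $ a = -1" by (simp add: power2_eq_1_iff)
    then show "poly r (u $ a) + poly r (- (u $ a)) = poly r 1 + poly r (-1)" by auto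
  qed
  finally show ?thesis by (simp add: q1)
qed

text \<open>Writing the monomial as \<open>u\<^sub>a\<^bsup>e a\<^esup>\<close> times a monomial of degree \<open>s\<close> in the other coordinates, the
  integral becomes \<open>C J(r q)\<close> with \<open>r = (1 - x\<^sup>2)\<^bsup>s/2\<^esup> x\<^bsup>e a\<^esup>\<close>, a polynomial of degree at most \<open>2d\<close>. It
  vanishes at \<open>\<plusminus>1\<close> unless \<open>s < 2\<close>, as the monomial does at the coordinate vector unless \<open>s = 0\<close>; for \<open>s = 1\<close>
  the exponent \<open>e a\<close> is odd and the values at \<open>\<plusminus>1\<close> cancel.\<close>

lemma monomial_kernel:
  fixes e :: "'n::finite \<Rightarrow> nat"
  assumes q: "q \<in> kernel_polys CARD('n) d k" and e: "(\<Sum>i\<in>UNIV. e i) = 2 * d"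
  shows "(\<integral>u. monomial e u * poly q (u $ a) \<partial>sphere_measure) = monomial e (axis a 1)"
proof -
  define e' where "e' = e(a := 0)"
  define s where "s = (\<Sum>i\<in>UNIV. e' i)"
  have split: "monomial e u = (u $ a) ^ e a * (\<Prod>i\<in>UNIV - {a}. (u $ i) ^ e i)" for u
    unfolding monomial_def by (subst prod.remove[of _ a]) auto
  have split': "monomial e' u = (\<Prod>i\<in>UNIV - {a}. (u $ i) ^ e i)" for u
    unfolding monomial_def by (subst prod.remove[of _ a]) (auto simp: e'_def)
  have s: "s = (\<Sum>i\<in>UNIV - {a}. e i)"
    unfolding s_def by (subst sum.remove[of _ a]) (auto simp: e'_def)
  have deg: "e a + s = 2 * d"
    using e unfolding s by (subst (asm) sum.remove[of _ a]) auto
  obtain C where C: "\<And>P. (\<integral>u. monomial e' u * poly P (u $ a) \<partial>sphere_measure)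
            = C * zonal_integral a (weight_poly ^ (s div 2) * P)"
    using monomial_zonal[of e' a] by (auto simp: e'_def s_def)
  define r where "r = weight_poly ^ (s div 2) * monom 1 (e a)"
  have "degree r \<le> degree (weight_poly ^ (s div 2)) + degree (monom (1::real) (e a))"
    unfolding r_def by (rule degree_mult_le)
  also have "\<dots> \<le> 2 * (s div 2) + e a"
    by (intro add_mono order_trans[OF degree_power_le] degree_monom_le) auto
  also have "\<dots> \<le> 2 * d" using deg by linarith
  finally have r: "degree r \<le> 2 * d" .
  have "(\<integral>u. monomial e u * poly q (u $ a) \<partial>sphere_measure)
      = (\<integral>u. monomial e' u * poly (monom 1 (e a) * q) (u $ a) \<partial>sphere_measure)"
    by (simp add: split split' poly_monom mult_ac)
  also have "\<dots> = C * zonal_integral a (r * q)"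
    by (simp only: C r_def mult.assoc)
  also have "\<dots> = C * ((poly r 1 + poly r (-1)) / 2)"
    by (simp only: zonal_kernel[OF q r])
  also have "\<dots> = monomial e (axis a 1)"
  proof (cases "s = 0")
    case True
    then have z: "\<And>i. i \<noteq> a \<Longrightarrow> e i = 0" by (auto simp: s)
    have 1: "monomial e' u = 1" for u
      unfolding split' using z by (intro prod.neutral) auto
    have "C * zonal_integral a 1 = 1" using C[of 1] True by (simp add: 1)
    then have "C = 1" by (simp add: zonal_integral_def)
    moreover have "even (e a)" using deg True by simp
    moreover have "monomial e (axis a 1) = 1" using 1 by (simp add: split split')
    ultimately show ?thesis using True by (simp add: r_def poly_monom)
  next
    case False
    then obtain i where i: "i \<noteq> a" "e i \<noteq> 0" by (auto simp: s)
    then have "monomial e (axis a 1) = 0"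
      unfolding monomial_def by (intro prod_zero) (auto simp: axis_def)
    moreover have "poly r 1 + poly r (-1) = 0"
    proof (cases "s = 1")
      case True
      then have "odd (e a)" using deg by presburger
      with True show ?thesis by (simp add: r_def poly_monom)
    next
      case s1: False
      then have "s div 2 \<noteq> 0" using False by linarith
      then show ?thesis by (simp add: r_def zero_power)
    qed
    ultimately show ?thesis by simp
  qed
  finally show ?thesis .
qed


section \<open>Forms and the reproducing property\<close>

lemma forms_def': "forms m = {p. \<exists>c. p = (\<lambda>x. \<Sum>e | (\<Sum>i\<in>UNIV. e i) = m. c e * monomial e x)}"
  by (simp add: forms_def monomial_def)

lemma finite_exponents: "finite {e :: 'n::finite \<Rightarrow> nat. (\<Sum>i\<in>UNIV. e i) = m}"
proof (rule finite_subset)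
  show "{e. (\<Sum>i\<in>UNIV. e i) = m} \<subseteq> (UNIV :: 'n set) \<rightarrow>\<^sub>E {..m}"
    by (auto intro!: member_le_sum)
  show "finite ((UNIV :: 'n set) \<rightarrow>\<^sub>E {..m})"
    by (intro finite_PiE) auto
qed

lemma forms_zero: "(\<lambda>x. 0) \<in> forms m"
  unfolding forms_def' by (auto intro!: exI[of _ "\<lambda>_. 0"])

lemma forms_add: "p \<in> forms m \<Longrightarrow> q \<in> forms m \<Longrightarrow> (\<lambda>x. p x + q x) \<in> forms m"
  unfolding forms_def'
  by clarify (auto simp: sum.distrib[symmetric] distrib_right[symmetric] intro!: exI[of _ "\<lambda>e. c e + c' e" for c c'])

lemma forms_cmult: "p \<in> forms m \<Longrightarrow> (\<lambda>x. c * p x) \<in> forms m"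
  unfolding forms_def'
  by clarify (auto simp: sum_distrib_left mult.assoc[symmetric] intro!: exI[of _ "\<lambda>e. c * c' e" for c c'])

lemma forms_diff: "p \<in> forms m \<Longrightarrow> q \<in> forms m \<Longrightarrow> (\<lambda>x. p x - q x) \<in> forms m"
  using forms_add[of p m "\<lambda>x. (-1) * q x"] forms_cmult[of q m "-1"] by simp

lemma forms_sum: "(\<And>i. i \<in> A \<Longrightarrow> p i \<in> forms m) \<Longrightarrow> (\<lambda>x. \<Sum>i\<in>A. p i x) \<in> forms m"
  by (induction A rule: infinite_finite_induct) (auto intro: forms_zero forms_add)

lemma forms_monomial: "(\<Sum>i\<in>UNIV. e i) = m \<Longrightarrow> monomial e \<in> forms m"
  unfolding forms_def'
  by (auto intro!: exI[of _ "\<lambda>e'. if e' = e then 1 else 0"] simp: if_distrib[of "\<lambda>c. c * _"] finite_exponents cong: if_cong)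

lemma forms_expand:
  assumes "p \<in> forms m"
  obtains c where "p = (\<lambda>x. \<Sum>e | (\<Sum>i\<in>UNIV. e i) = m. c e * monomial e x)"
  using assms unfolding forms_def' by auto

lemma forms_mult:
  assumes "p \<in> forms m" "q \<in> forms m'"
  shows "(\<lambda>x. p x * q x) \<in> forms (m + m')"
proof -
  obtain c where c: "p = (\<lambda>x. \<Sum>e | (\<Sum>i\<in>UNIV. e i) = m. c e * monomial e x)"
    using assms(1) by (rule forms_expand)
  obtain c' where c': "q = (\<lambda>x. \<Sum>e | (\<Sum>i\<in>UNIV. e i) = m'. c' e * monomial e x)"
    using assms(2) by (rule forms_expand)
  have "(\<lambda>x. \<Sum>e | (\<Sum>i\<in>UNIV. e i) = m. \<Sum>f | (\<Sum>i\<in>UNIV. f i) = m'. (c e * c' f) * monomial (\<lambda>i. e i + f i) x) \<in> forms (m + m')"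
    by (intro forms_sum forms_cmult forms_monomial) (auto simp: sum.distrib)
  also have "(\<lambda>x. \<Sum>e | (\<Sum>i\<in>UNIV. e i) = m. \<Sum>f | (\<Sum>i\<in>UNIV. f i) = m'. (c e * c' f) * monomial (\<lambda>i. e i + f i) x) = (\<lambda>x. p x * q x)"
    unfolding c c' sum_product monomial_def power_add prod.distrib
    by (intro ext sum.cong refl) (simp add: mult_ac)
  finally show ?thesis .
qed

lemma forms_const: "(\<lambda>x. c) \<in> forms 0"
  using forms_cmult[OF forms_monomial[of "\<lambda>_. 0" 0], of c] by (simp add: monomial_def)

lemma forms_power:
  assumes "p \<in> forms m"
  shows "(\<lambda>x. p x ^ i) \<in> forms (m * i)"
proof (induction i)
  case (Suc i)
  with forms_mult[OF assms Suc.IH] show ?case by simp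
qed (simp add: forms_const)

lemma forms_prod:
  "(\<And>i. i \<in> A \<Longrightarrow> p i \<in> forms (m i)) \<Longrightarrow> (\<lambda>x. \<Prod>i\<in>A. p i x) \<in> forms (\<Sum>i\<in>A. m i)"
  by (induction A rule: infinite_finite_induct) (auto intro: forms_const forms_mult)

lemma forms_coordinate: "(\<lambda>x. x $ a) \<in> forms 1"
proof -
  have "monomial (\<lambda>i. if i = a then 1 else 0) = (\<lambda>x. x $ a)"
    unfolding monomial_def by (rule ext, subst prod.remove[of _ a]) auto
  then show ?thesis
    using forms_monomial[of "\<lambda>i. if i = a then 1 else 0" 1] by simp
qed

lemma forms_inner: "(\<lambda>x. x \<bullet> v) \<in> forms 1"
  unfolding inner_vec_def inner_real_def
  by (intro forms_sum) (simp only: mult.commute[of "_ $ _" "v $ _"] forms_cmult[OF forms_coordinate])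

lemma forms_compose_linear:
  fixes T :: "real^'n::finite \<Rightarrow> real^'n"
  assumes p: "p \<in> forms m" and T: "linear T"
  shows "(\<lambda>x. p (T x)) \<in> forms m"
proof -
  obtain c where c: "p = (\<lambda>x. \<Sum>e | (\<Sum>i\<in>UNIV. e i) = m. c e * monomial e x)"
    using p by (rule forms_expand)
  have coord: "(\<lambda>x. T x $ i) \<in> forms 1" for i
  proof -
    have "T x $ i = x \<bullet> adjoint T (axis i 1)" for x
      using adjoint_works[OF T, of x "axis i 1"] by (simp add: inner_axis)
    then show ?thesis using forms_inner by simp
  qed
  have "(\<lambda>x. monomial e (T x)) \<in> forms m" if "(\<Sum>i\<in>UNIV. e i) = m" for e
    unfolding monomial_def using forms_prod[of UNIV "\<lambda>i x. (T x $ i) ^ e i" e] forms_power[OF coord] that by simp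
  then show ?thesis
    unfolding c by (intro forms_sum forms_cmult) auto
qed

lemma forms_continuous: "p \<in> forms m \<Longrightarrow> continuous_on A p"
  by (erule forms_expand) (auto intro!: continuous_intros)

lemma forms_scaleR:
  assumes "p \<in> forms m"
  shows "p (c *\<^sub>R x) = c ^ m * p x"
proof -
  have "monomial e (c *\<^sub>R x) = c ^ m * monomial e x" if "(\<Sum>i\<in>UNIV. e i) = m" for e
    using that by (auto simp: monomial_def power_mult_distrib prod.distrib power_sum)
  with assms show ?thesis
    by (elim forms_expand) (auto simp: sum_distrib_left mult_ac intro!: sum.cong)
qed

lemma forms_norm_form: "norm_form d \<in> forms (2 * d)"
proof -
  have "(\<lambda>x. (\<Sum>i\<in>UNIV. (x $ i)\<^sup>2) ^ d) \<in> forms (2 * d)"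
    using forms_power[OF forms_coordinate, of _ 2] by (intro forms_power forms_sum) simp
  then show ?thesis by (simp add: norm_form_def[abs_def])
qed

lemma sum_squares_sphere: "norm u = 1 \<Longrightarrow> (\<Sum>i\<in>UNIV. (u $ i)\<^sup>2) = 1" for u :: "real^'n::finite"
  by (simp add: norm_eq_1 inner_vec_def power2_eq_square)

lemma norm_form_sphere: "norm u = 1 \<Longrightarrow> norm_form d u = 1"
  by (simp add: norm_form_def sum_squares_sphere)

text \<open>Rotate \<open>v\<close> to a coordinate vector, which turns \<open>l\<close> into another form of the same degree, and
  expand that form into monomials.\<close>

lemma form_kernel_reproducing:
  fixes l :: "real^'n::finite \<Rightarrow> real"
  assumes q: "q \<in> kernel_polys CARD('n) d k" and l: "l \<in> forms (2 * d)" and v: "norm v = 1"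
  shows "(\<integral>u. l u * poly q (u \<bullet> v) \<partial>sphere_measure) = l v"
proof -
  define a where "a = (undefined :: 'n)"
  obtain T :: "real^'n \<Rightarrow> real^'n" where T: "orthogonal_transformation T" "T (axis a 1) = v"
    using orthogonal_transformation_exists_1[of "axis a 1" v] v norm_axis_1[of a] that by metis
  define l' where "l' x = l (T x)" for x
  have "l' \<in> forms (2 * d)"
    unfolding l'_def by (rule forms_compose_linear[OF l orthogonal_transformation_linear[OF T(1)]])
  then obtain c where c: "l' = (\<lambda>x. \<Sum>e | (\<Sum>i\<in>UNIV. e i) = 2 * d. c e * monomial e x)"
    by (rule forms_expand)
  have inner: "T u \<bullet> v = u $ a" for u
  proof -
    have "T u \<bullet> T (axis a 1) = u \<bullet> axis a 1"
      using T(1) by (simp add: orthogonal_transformation_def)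
    then show ?thesis by (simp add: T(2) inner_axis)
  qed
  have "(\<integral>u. l u * poly q (u \<bullet> v) \<partial>sphere_measure) = (\<integral>u. l (T u) * poly q (T u \<bullet> v) \<partial>sphere_measure)"
    by (rule sphere_integral_orthogonal[OF T(1), symmetric])
      (intro borel_measurable_continuous_onI continuous_intros forms_continuous[OF l])
  also have "\<dots> = (\<integral>u. l' u * poly q (u $ a) \<partial>sphere_measure)"
    by (simp only: inner l'_def)
  also have "\<dots> = (\<integral>u. (\<Sum>e | (\<Sum>i\<in>UNIV. e i) = 2 * d. c e * (monomial e u * poly q (u $ a))) \<partial>sphere_measure)"
    by (simp add: c sum_distrib_right mult.assoc)
  also have "\<dots> = (\<Sum>e | (\<Sum>i\<in>UNIV. e i) = 2 * d. \<integral>u. c e * (monomial e u * poly q (u $ a)) \<partial>sphere_measure)"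
    by (intro Bochner_Integration.integral_sum sphere_integrable continuous_intros)
  also have "\<dots> = l' (axis a 1)"
    unfolding c using monomial_kernel[OF q] by (auto intro!: sum.cong)
  also have "\<dots> = l v" by (simp add: l'_def T)
  finally show ?thesis .
qed


section \<open>Zonal sums of squares\<close>

text \<open>The cone is defined by squares of forms of degree exactly \<open>2k\<close>. Lower degrees, of either parity,
  reduce to it through \<open>f\<^sup>2 = \<Sum>\<^sub>i (u\<^sub>i f)\<^sup>2\<close> on the sphere.\<close>

lemma dual_cone_square_nonneg:
  fixes l f :: "real^'n::finite \<Rightarrow> real"
  assumes l: "l \<in> dual_cone d (sphere_forms k)" and j: "j \<le> 2 * k" and f: "f \<in> forms j"
  shows "0 \<le> (\<integral>u. l u * (f u)\<^sup>2 \<partial>sphere_measure)"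
  using j f
proof (induction j arbitrary: f rule: inc_induct)
  case base
  then have "0 \<le> (\<integral>u. l u * (restrict f (sphere 0 1) u)\<^sup>2 \<partial>sphere_measure)"
    using l by (auto simp: dual_cone_def sphere_forms_def)
  also have "\<dots> = (\<integral>u. l u * (f u)\<^sup>2 \<partial>sphere_measure)"
    by (intro sphere_integral_cong) simp
  finally show ?case .
next
  case (step j)
  have lf: "l \<in> forms (2 * d)" using l by (simp add: dual_cone_def)
  have "0 \<le> (\<Sum>i\<in>UNIV. \<integral>u. l u * (u $ i * f u)\<^sup>2 \<partial>sphere_measure)"
    using forms_mult[OF forms_coordinate step.prems] by (intro sum_nonneg step.IH) simp
  also have "\<dots> = (\<integral>u. (\<Sum>i\<in>UNIV. l u * (u $ i * f u)\<^sup>2) \<partial>sphere_measure)"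
    by (intro Bochner_Integration.integral_sum[symmetric] sphere_integrable continuous_intros
        forms_continuous[OF lf] forms_continuous[OF step.prems])
  also have "\<dots> = (\<integral>u. l u * (f u)\<^sup>2 * (\<Sum>i\<in>UNIV. (u $ i)\<^sup>2) \<partial>sphere_measure)"
    by (simp add: sum_distrib_left power_mult_distrib mult_ac)
  also have "\<dots> = (\<integral>u. l u * (f u)\<^sup>2 \<partial>sphere_measure)"
    by (intro sphere_integral_cong) (simp add: sum_squares_sphere)
  finally show ?case .
qed

lemma poly_nonneg_Icc_insert:
  fixes R :: "real poly"
  assumes "y0 \<in> {0..1}" and "\<And>y. y \<in> {0..1} \<Longrightarrow> y \<noteq> y0 \<Longrightarrow> 0 \<le> poly R y" and "y \<in> {0..1}"
  shows "0 \<le> poly R y"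
proof (cases "y = y0")
  case True
  have "(poly R \<longlongrightarrow> poly R y0) (at y0 within {0..1})"
    by (intro tendsto_poly tendsto_ident_at)
  moreover have "\<forall>\<^sub>F y in at y0 within {0..1}. 0 \<le> poly R y"
    using assms(2) by (auto simp: eventually_at_filter)
  moreover have "at y0 within {0..1} \<noteq> bot"
    using assms(1) by (simp add: trivial_limit_within islimpt_Icc)
  ultimately show ?thesis using True by (simp add: tendsto_lowerbound)
qed (use assms in auto)

lemma degree_linear_factor:
  fixes F Q :: "real poly"
  assumes "Q \<noteq> 0" "degree F = 1"
  shows "degree (F * Q) = Suc (degree Q)"
proof -
  have "F \<noteq> 0" using assms(2) by auto
  then show ?thesis using assms by (simp add: degree_mult_eq)
qed

text \<open>After subtraction of its minimum over \<open>[0, 1]\<close> the polynomial vanishes at a minimizer \<open>y\<^sub>0\<close>. At an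
  end point this gives the factor \<open>y\<close> or \<open>1 - y\<close>, and at an interior point the root is double. The
  quotient is nonnegative away from \<open>y\<^sub>0\<close>, hence also at \<open>y\<^sub>0\<close> by continuity. This replaces the
  factorization over the complex numbers in the usual proofs of such positivity certificates.\<close>

lemma nonneg_poly_peel_minimum:
  fixes P :: "real poly"
  assumes nonneg: "\<And>y. y \<in> {0..1} \<Longrightarrow> 0 \<le> poly P y" and deg: "degree P \<noteq> 0"
  obtains c F Q where "0 \<le> c" "P = [:c:] + F * Q" "\<And>y. y \<in> {0..1} \<Longrightarrow> 0 \<le> poly Q y"
    and "degree P = degree Q + degree F"
    and "F = [:0, 1:] \<or> F = [:1, -1:] \<or> (\<exists>y0. F = [:- y0, 1:]\<^sup>2)"
proof -
  have "continuous_on {0..1} (poly P)" by (intro continuous_intros)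
  then obtain y0 where y0: "y0 \<in> {0..1}" "\<And>y. y \<in> {0..1} \<Longrightarrow> poly P y0 \<le> poly P y"
    using continuous_attains_inf[of "{0..1::real}" "poly P"] by fastforce
  define c where "c = poly P y0"
  have c: "c \<ge> 0" using nonneg y0 by (simp add: c_def)
  have "[:- y0, 1:] dvd P - [:c:]" by (simp add: c_def flip: poly_eq_0_iff_dvd)
  then obtain Q where Q: "P - [:c:] = [:- y0, 1:] * Q" by (elim dvdE)
  then have PQ: "P = [:c:] + [:- y0, 1:] * Q" by (simp add: algebra_simps)
  have "Q \<noteq> 0"
  proof
    assume "Q = 0"
    then have "P = [:c:]" using PQ by simp
    then show False using deg by simp
  qed
  then have degF: "degree ([:- y0, 1:] * Q) = Suc (degree Q)"
    by (intro degree_linear_factor) auto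
  have degP: "degree P = Suc (degree Q)"
    unfolding PQ using degF by (subst degree_add_eq_right) (simp_all only: degree_pCons_0 zero_less_Suc)
  have Qnonneg: "0 \<le> (y - y0) * poly Q y" if "y \<in> {0..1}" for y
    using y0(2)[OF that] arg_cong[OF PQ, of "\<lambda>p. poly p y"] by (simp add: c_def algebra_simps)
  consider "y0 = 0" | "y0 = 1" | "0 < y0" "y0 < 1" using y0(1) by fastforce
  then show ?thesis
  proof cases
    case 1
    have nonneg: "0 \<le> poly Q y" if "y \<in> {0..1}" for y
    proof (rule poly_nonneg_Icc_insert[OF y0(1) _ that])
      fix z assume "z \<in> {0..1}" "z \<noteq> y0"
      then show "0 \<le> poly Q z" using Qnonneg[of z] 1 by (auto simp: zero_le_mult_iff)
    qed
    have eq: "P = [:c:] + [:0, 1:] * Q" unfolding PQ by (simp only: 1 minus_zero)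
    show ?thesis
      by (rule that[OF c eq nonneg]) (simp_all add: degP)
  next
    case 2
    have nonneg: "0 \<le> poly (- Q) y" if "y \<in> {0..1}" for y
    proof (rule poly_nonneg_Icc_insert[OF y0(1) _ that])
      fix z assume "z \<in> {0..1}" "z \<noteq> y0"
      then show "0 \<le> poly (- Q) z" using Qnonneg[of z] 2 by (auto simp: zero_le_mult_iff)
    qed
    have eq: "P = [:c:] + [:1, -1:] * (- Q)"
      unfolding PQ by (simp only: mult_minus_right) (simp add: 2)
    show ?thesis
      by (rule that[OF c eq nonneg]) (simp_all add: degP)
  next
    case 3
    have "(poly P has_real_derivative poly (pderiv P) y0) (at y0)" by simp
    then have "poly (pderiv P) y0 = 0"
    proof (rule DERIV_local_min)
      show "0 < min y0 (1 - y0)" using 3 by simp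
      show "\<forall>y. \<bar>y0 - y\<bar> < min y0 (1 - y0) \<longrightarrow> poly P y0 \<le> poly P y"
        by (intro allI impI y0(2)) (auto simp: abs_if split: if_splits)
    qed
    moreover have "pderiv P = Q + [:- y0, 1:] * pderiv Q"
      unfolding PQ by (simp only: pderiv_add pderiv_mult) (simp add: pderiv_pCons)
    ultimately have "poly Q y0 = 0" by simp
    then have "[:- y0, 1:] dvd Q" by (simp only: poly_eq_0_iff_dvd)
    then obtain R where QR: "Q = [:- y0, 1:] * R" by (elim dvdE)
    have "R \<noteq> 0" using QR \<open>Q \<noteq> 0\<close> by auto
    then have degQ: "degree Q = Suc (degree R)"
      unfolding QR by (intro degree_linear_factor) auto
    have nonneg: "0 \<le> poly R y" if "y \<in> {0..1}" for y
    proof (rule poly_nonneg_Icc_insert[OF y0(1) _ that])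
      fix z assume z: "z \<in> {0..1}" "z \<noteq> y0"
      have "poly Q z = (z - y0) * poly R z"
        unfolding QR by (simp add: algebra_simps)
      then have "0 \<le> (z - y0)\<^sup>2 * poly R z"
        using Qnonneg[OF z(1)] by (simp add: power2_eq_square mult.assoc)
      then show "0 \<le> poly R z" using z by (simp add: zero_le_mult_iff)
    qed
    have eq: "P = [:c:] + [:- y0, 1:]\<^sup>2 * R"
      using PQ by (simp only: QR power2_eq_square mult.assoc)
    have "degree ([:- y0, 1:]\<^sup>2) = 2"
      by (simp add: degree_power_eq)
    with degP degQ show ?thesis
      by (intro that[OF c eq nonneg]) auto
  qed
qed

lemma sum_squares_orthogonal_part:
  fixes u v :: "real^'n::finite"
  assumes "norm u = 1" "norm v = 1"
  shows "(\<Sum>i\<in>UNIV. (u $ i - v $ i * (u \<bullet> v))\<^sup>2) = 1 - (u \<bullet> v)\<^sup>2"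
proof -
  have "(\<Sum>i\<in>UNIV. (u $ i - v $ i * (u \<bullet> v))\<^sup>2) = (u - (u \<bullet> v) *\<^sub>R v) \<bullet> (u - (u \<bullet> v) *\<^sub>R v)"
    by (simp add: inner_vec_def power2_eq_square mult.commute)
  also have "\<dots> = 1 - (u \<bullet> v)\<^sup>2"
    using assms by (simp add: inner_diff_left inner_diff_right norm_eq_1 power2_eq_square inner_commute)
  finally show ?thesis .
qed

text \<open>Induction on the degree of \<open>P\<close>, with the square of a form \<open>f\<close> as an accumulator: after the minimum
  is split off, the factor of \<open>P\<close> is moved into \<open>f\<close>, as it is a sum of squares of forms at
  \<open>y = \<langle>u, v\<rangle>\<^sup>2\<close> with \<open>|u| = 1\<close>. Indeed \<open>y\<close> is the square of \<open>\<langle>u, v\<rangle>\<close>, \<open>1 - y\<close> is the squared length of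
  \<open>u - \<langle>u, v\<rangle>v\<close>, and \<open>y - y\<^sub>0\<close> is the form \<open>\<langle>u, v\<rangle>\<^sup>2 - y\<^sub>0 |u|\<^sup>2\<close>. The degree lost by \<open>P\<close> is the degree
  gained by \<open>f\<close>.\<close>

lemma dual_cone_zonal_nonneg:
  fixes l f :: "real^'n::finite \<Rightarrow> real"
  assumes l: "l \<in> dual_cone d (sphere_forms k)" and v: "norm v = 1"
    and "\<And>y. y \<in> {0..1} \<Longrightarrow> 0 \<le> poly P y" and "f \<in> forms j" and "degree P + j \<le> 2 * k"
  shows "0 \<le> (\<integral>u. l u * poly P ((u \<bullet> v)\<^sup>2) * (f u)\<^sup>2 \<partial>sphere_measure)"
  using assms(3-)
proof (induction "degree P" arbitrary: P f j rule: less_induct)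
  case less
  note f = \<open>f \<in> forms j\<close>
  have lf: "l \<in> forms (2 * d)" using l by (simp add: dual_cone_def)
  note cont = continuous_intros forms_continuous[OF lf] forms_continuous[OF f]
  have square: "0 \<le> (\<integral>u. l u * (f u)\<^sup>2 \<partial>sphere_measure)"
    using less.prems by (intro dual_cone_square_nonneg[OF l _ f]) auto
  show ?case
  proof (cases "degree P = 0")
    case True
    then obtain c where P: "P = [:c:]" by (metis degree_eq_zeroE)
    with less.prems(1)[of 0] have "c \<ge> 0" by simp
    moreover have "(\<integral>u. l u * c * (f u)\<^sup>2 \<partial>sphere_measure) = c * (\<integral>u. l u * (f u)\<^sup>2 \<partial>sphere_measure)"
      by (simp add: mult.commute[of _ c] mult.assoc)
    ultimately show ?thesis using square by (simp add: P)
  next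
    case False
    obtain c F Q where c: "0 \<le> c" and P: "P = [:c:] + F * Q"
      and Q: "\<And>y. y \<in> {0..1} \<Longrightarrow> 0 \<le> poly Q y" and degP: "degree P = degree Q + degree F"
      and F: "F = [:0, 1:] \<or> F = [:1, -1:] \<or> (\<exists>y0. F = [:- y0, 1:]\<^sup>2)"
      using nonneg_poly_peel_minimum[OF less.prems(1) False] by blast
    have IH: "0 \<le> (\<integral>u. l u * poly Q ((u \<bullet> v)\<^sup>2) * (g u * f u)\<^sup>2 \<partial>sphere_measure)"
      if "g \<in> forms (degree F)" "0 < degree F" for g
      using less.prems(3) degP that Q by (intro less.hyps[OF _ _ forms_mult[OF that(1) f]]) auto
    have "0 \<le> (\<integral>u. l u * (poly F ((u \<bullet> v)\<^sup>2) * poly Q ((u \<bullet> v)\<^sup>2)) * (f u)\<^sup>2 \<partial>sphere_measure)"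
    proof -
      consider "F = [:0, 1:]" | "F = [:1, -1:]" | y0 where "F = [:- y0, 1:]\<^sup>2" using F by blast
      then show ?thesis
      proof cases
        case 1
        then have "0 \<le> (\<integral>u. l u * poly Q ((u \<bullet> v)\<^sup>2) * ((u \<bullet> v) * f u)\<^sup>2 \<partial>sphere_measure)"
          using forms_inner by (intro IH) auto
        then show ?thesis by (simp add: 1 power_mult_distrib mult_ac)
      next
        case 2
        have "(\<lambda>u. u $ i - v $ i * (u \<bullet> v)) \<in> forms 1" for i
          by (intro forms_diff forms_cmult forms_coordinate forms_inner)
        then have "0 \<le> (\<Sum>i\<in>UNIV. \<integral>u. l u * poly Q ((u \<bullet> v)\<^sup>2) * ((u $ i - v $ i * (u \<bullet> v)) * f u)\<^sup>2 \<partial>sphere_measure)"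
          using 2 by (intro sum_nonneg IH) auto
        also have "\<dots> = (\<integral>u. (\<Sum>i\<in>UNIV. l u * poly Q ((u \<bullet> v)\<^sup>2) * ((u $ i - v $ i * (u \<bullet> v)) * f u)\<^sup>2) \<partial>sphere_measure)"
          by (intro Bochner_Integration.integral_sum[symmetric] sphere_integrable cont)
        also have "\<dots> = (\<integral>u. l u * (poly F ((u \<bullet> v)\<^sup>2) * poly Q ((u \<bullet> v)\<^sup>2)) * (f u)\<^sup>2 \<partial>sphere_measure)"
        proof (rule sphere_integral_cong)
          fix u :: "real^'n" assume u: "norm u = 1"
          have "(\<Sum>i\<in>UNIV. l u * poly Q ((u \<bullet> v)\<^sup>2) * ((u $ i - v $ i * (u \<bullet> v)) * f u)\<^sup>2)
              = (\<Sum>i\<in>UNIV. (u $ i - v $ i * (u \<bullet> v))\<^sup>2) * (l u * poly Q ((u \<bullet> v)\<^sup>2) * (f u)\<^sup>2)"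
            unfolding sum_distrib_right by (intro sum.cong refl) (simp only: power_mult_distrib mult_ac)
          also have "\<dots> = l u * (poly F ((u \<bullet> v)\<^sup>2) * poly Q ((u \<bullet> v)\<^sup>2)) * (f u)\<^sup>2"
            unfolding sum_squares_orthogonal_part[OF u v] by (simp add: 2)
          finally show "(\<Sum>i\<in>UNIV. l u * poly Q ((u \<bullet> v)\<^sup>2) * ((u $ i - v $ i * (u \<bullet> v)) * f u)\<^sup>2)
              = l u * (poly F ((u \<bullet> v)\<^sup>2) * poly Q ((u \<bullet> v)\<^sup>2)) * (f u)\<^sup>2" .
        qed
        finally show ?thesis .
      next
        case (3 y0)
        have degF: "degree F = 2" by (simp add: 3 degree_power_eq)
        have "(\<lambda>u. (u \<bullet> v)\<^sup>2 - y0 * (\<Sum>i\<in>UNIV. (u $ i)\<^sup>2)) \<in> forms 2"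
          using forms_power[OF forms_inner, of v 2] forms_power[OF forms_coordinate, of _ 2]
          by (intro forms_diff forms_cmult forms_sum) auto
        then have "0 \<le> (\<integral>u. l u * poly Q ((u \<bullet> v)\<^sup>2) * (((u \<bullet> v)\<^sup>2 - y0 * (\<Sum>i\<in>UNIV. (u $ i)\<^sup>2)) * f u)\<^sup>2 \<partial>sphere_measure)"
          using degF by (intro IH) auto
        also have "\<dots> = (\<integral>u. l u * (poly F ((u \<bullet> v)\<^sup>2) * poly Q ((u \<bullet> v)\<^sup>2)) * (f u)\<^sup>2 \<partial>sphere_measure)"
          by (intro sphere_integral_cong) (simp add: 3 sum_squares_sphere power_mult_distrib)
        finally show ?thesis .
      qed
    qed
    moreover have "(\<integral>u. l u * poly P ((u \<bullet> v)\<^sup>2) * (f u)\<^sup>2 \<partial>sphere_measure)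
        = (\<integral>u. c * (l u * (f u)\<^sup>2) + l u * (poly F ((u \<bullet> v)\<^sup>2) * poly Q ((u \<bullet> v)\<^sup>2)) * (f u)\<^sup>2 \<partial>sphere_measure)"
      unfolding P by (simp add: algebra_simps)
    moreover have "\<dots> = (\<integral>u. c * (l u * (f u)\<^sup>2) \<partial>sphere_measure)
        + (\<integral>u. l u * (poly F ((u \<bullet> v)\<^sup>2) * poly Q ((u \<bullet> v)\<^sup>2)) * (f u)\<^sup>2 \<partial>sphere_measure)"
      by (intro Bochner_Integration.integral_add sphere_integrable cont)
    ultimately show ?thesis
      using square c by simp
  qed
qed

lemma even_poly_as_square:
  fixes p :: "real poly"
  assumes "pcompose p [:0, -1:] = p" and "degree p \<le> 2 * k"
  obtains P where "degree P \<le> k" "\<And>x. poly p x = poly P (x\<^sup>2)"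
proof
  let ?P = "\<Sum>i\<le>k. monom (coeff p (2 * i)) i"
  show "degree ?P \<le> k"
    by (intro degree_sum_le) (auto intro: order_trans[OF degree_monom_le])
  have odd: "coeff p i = 0" if "odd i" for i
  proof -
    have "coeff (pcompose p [:0, -1:]) i = - coeff p i"
      using that by (simp add: coeff_pcompose_linear)
    with assms(1) show ?thesis by simp
  qed
  show "poly p x = poly ?P (x\<^sup>2)" for x
  proof -
    have "poly p x = (\<Sum>i\<le>2 * k. coeff p i * x ^ i)"
      using assms(2) by (subst poly_altdef, intro sum.mono_neutral_left) (auto simp: coeff_eq_0)
    also have "\<dots> = (\<Sum>i\<le>k. coeff p (2 * i) * x ^ (2 * i))"
      by (induction k) (simp_all add: odd)
    also have "\<dots> = poly ?P (x\<^sup>2)"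
      by (simp add: poly_sum poly_monom power_mult)
    finally show ?thesis .
  qed
qed

lemma kernel_poly_as_square:
  assumes "q \<in> kernel_polys n d k" "k \<ge> d"
  obtains P where "degree P \<le> k" "\<And>x. poly q x = poly P (x\<^sup>2)"
proof -
  obtain b where q: "q = (\<Sum>j=0..d. smult (harm_dim n (2 * j)) (legendre n (2 * j)))
       + (\<Sum>j=d+1..k. smult (b j) (legendre n (2 * j)))"
    using assms(1) by (auto simp: kernel_polys_def)
  have "pcompose q [:0, -1:] = q"
    by (simp add: q pcompose_add pcompose_sum pcompose_smult legendre_reflect)
  moreover have "degree q \<le> 2 * k"
    unfolding q using assms(2)
    by (intro degree_add_le degree_sum_le order_trans[OF degree_smult_le] order_trans[OF degree_legendre]) auto
  ultimately show thesis
    using that by (rule even_poly_as_square)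
qed

lemma dual_base_approx_ge:
  fixes l :: "real^'n::finite \<Rightarrow> real"
  assumes q: "q \<in> kernel_polys CARD('n) d k" and dk: "k \<ge> d"
    and M: "\<And>x. x \<in> {-1..1} \<Longrightarrow> M \<le> poly q x"
    and l: "l \<in> dual_base_approx d (sphere_forms k)" and v: "norm v = 1"
  shows "M \<le> l v"
proof -
  have lc: "l \<in> dual_cone d (sphere_forms k)" and lf: "l \<in> forms (2 * d)" and l1: "(\<integral>u. l u \<partial>sphere_measure) = 1"
    using l by (auto simp: dual_base_approx_def dual_hyperplane_def)
  obtain P where P: "degree P \<le> k" "\<And>x. poly q x = poly P (x\<^sup>2)"
    using kernel_poly_as_square[OF q dk] by blast
  have "0 \<le> (\<integral>u. l u * poly (P - [:M:]) ((u \<bullet> v)\<^sup>2) * 1\<^sup>2 \<partial>sphere_measure)"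
  proof (rule dual_cone_zonal_nonneg[OF lc v _ forms_const])
    show "0 \<le> poly (P - [:M:]) y" if "y \<in> {0..1}" for y
      using M[of "sqrt y"] P(2)[of "sqrt y"] that by (simp add: order_trans[of "-1" 0 "sqrt y"])
    have "degree (P - [:M:]) \<le> k" using P(1) by (intro degree_diff_le) auto
    then show "degree (P - [:M:]) + 0 \<le> 2 * k" by simp
  qed
  also have "\<dots> = (\<integral>u. l u * poly q (u \<bullet> v) - M * l u \<partial>sphere_measure)"
    by (simp add: P(2) algebra_simps)
  also have "\<dots> = (\<integral>u. l u * poly q (u \<bullet> v) \<partial>sphere_measure) - (\<integral>u. M * l u \<partial>sphere_measure)"
    by (intro Bochner_Integration.integral_diff sphere_integrable continuous_intros forms_continuous[OF lf])
  also have "\<dots> = l v - M"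
    by (simp add: form_kernel_reproducing[OF q lf v] l1)
  finally show ?thesis by simp
qed

text \<open>The average of \<open>q(\<langle>u, v\<rangle>)\<close> over the sphere is \<open>1\<close>, by the reproducing property of the form that is
  constant on the sphere.\<close>

lemma kernel_poly_lower_bound_le_1:
  assumes q: "q \<in> kernel_polys CARD('n::finite) d k" and M: "\<And>x. x \<in> {-1..1} \<Longrightarrow> M \<le> poly q x"
  shows "M \<le> 1"
proof -
  define v :: "real^'n" where "v = axis undefined 1"
  have v: "norm v = 1" unfolding v_def by (rule norm_axis_1)
  have "0 \<le> (\<integral>u. poly q (u \<bullet> v) - M \<partial>sphere_measure)"
  proof (rule sphere_integral_nonneg)
    fix u :: "real^'n" assume "norm u = 1"
    then have "\<bar>u \<bullet> v\<bar> \<le> 1"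
      using Cauchy_Schwarz_ineq2[of u v] v by simp
    then have "u \<bullet> v \<in> {-1..1}" by auto
    from M[OF this] show "0 \<le> poly q (u \<bullet> v) - M" by simp
  qed
  also have "\<dots> = (\<integral>u. poly q (u \<bullet> v) \<partial>sphere_measure) - (\<integral>(u::real^'n). M \<partial>sphere_measure)"
    by (intro Bochner_Integration.integral_diff sphere_integrable continuous_intros)
  also have "(\<integral>u. poly q (u \<bullet> v) \<partial>sphere_measure) = (\<integral>u. norm_form d u * poly q (u \<bullet> v) \<partial>sphere_measure)"
    by (intro sphere_integral_cong) (simp add: norm_form_sphere)
  also have "\<dots> = 1"
    by (simp add: form_kernel_reproducing[OF q forms_norm_form v] norm_form_sphere v)
  finally show ?thesis by simp
qed

text \<open>On the sphere the rescaled form is \<open>1 + (l - 1) / a\<close>, which is nonnegative by the bound on \<open>l\<close>;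
  homogeneity of even degree extends this to the whole space.\<close>

lemma scaling_constant_le:
  assumes d: "d \<ge> 1" and a: "0 < a"
    and ge: "\<And>l v :: real^'n::finite. l \<in> dual_base_approx d F \<Longrightarrow> norm v = 1 \<Longrightarrow> 1 - a \<le> l v"
  shows "scaling_constant d F \<le> ereal a"
proof -
  have "(\<lambda>x. (1 / a) * (l x - norm_form d x)) \<in> (\<lambda>l x. l x - norm_form d x) ` dual_base d"
    if l: "l \<in> dual_base_approx d F" for l :: "real^'n \<Rightarrow> real"
  proof -
    define p where "p x = (1 / a) * (l x - norm_form d x) + norm_form d x" for x
    have eq: "(\<lambda>x. (1 / a) * (l x - norm_form d x)) = (\<lambda>l x. l x - norm_form d x) p"
      by (simp add: p_def)
    have lf: "l \<in> forms (2 * d)" and l1: "(\<integral>u. l u \<partial>sphere_measure) = 1"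
      using l by (auto simp: dual_base_approx_def dual_hyperplane_def)
    have pf: "p \<in> forms (2 * d)"
      unfolding p_def by (intro forms_add forms_cmult forms_diff lf forms_norm_form)
    have on_sphere: "0 \<le> p v" if "norm v = 1" for v
      using ge[OF l that] a by (simp add: p_def norm_form_sphere that field_simps)
    have "0 \<le> p x" for x
    proof (cases "x = 0")
      case True
      then show ?thesis using forms_scaleR[OF pf, of 0 x] d by (simp add: zero_power)
    next
      case False
      then have "p x = norm x ^ (2 * d) * p (x /\<^sub>R norm x)"
        using forms_scaleR[OF pf, of "norm x" "x /\<^sub>R norm x"] by simp
      then show ?thesis using on_sphere[of "x /\<^sub>R norm x"] False by simp
    qed
    moreover have "(\<integral>u. p u \<partial>sphere_measure) = 1"
    proof -
      have "(\<integral>u. p u \<partial>sphere_measure) = (\<integral>u. (1 / a) * (l u - 1) + 1 \<partial>sphere_measure)"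
        by (intro sphere_integral_cong) (simp add: p_def norm_form_sphere)
      also have "\<dots> = (1 / a) * ((\<integral>u. l u \<partial>sphere_measure) - (\<integral>(u::real^'n). 1 \<partial>sphere_measure)) + (\<integral>(u::real^'n). 1 \<partial>sphere_measure)"
        by (simp only: Bochner_Integration.integral_add Bochner_Integration.integral_diff
            Bochner_Integration.integral_mult_right_zero sphere_integrable continuous_intros forms_continuous[OF lf])
      also have "\<dots> = 1" by (simp add: l1)
      finally show ?thesis .
    qed
    ultimately have "p \<in> dual_base d"
      using pf by (simp add: dual_base_def nonneg_forms_def dual_hyperplane_def)
    with eq show ?thesis by (rule image_eqI)
  qed
  then show ?thesis
    unfolding scaling_constant_def using a by (intro Inf_lower) auto
qed

theorem theorem1p8:
  fixes d k :: nat
  assumes "d \<ge> 1" and "k \<ge> d"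
  shows "scaling_constant d (sphere_forms k :: (real ^ 'n::finite \<Rightarrow> real) set)
           \<le> 1 - (SUP q \<in> kernel_polys CARD('n) d k. ereal (INF x\<in>{-1..1}. poly q x))
         \<and> (\<forall>q \<in> kernel_polys CARD('n) d k.
              scaling_constant d (sphere_forms k :: (real ^ 'n \<Rightarrow> real) set)
                \<le> ereal (1 - (INF x\<in>{-1..1}. poly q x)))"
proof -
  let ?S = "scaling_constant d (sphere_forms k :: (real ^ 'n \<Rightarrow> real) set)"
  have bound: "?S \<le> ereal (1 - (INF x\<in>{-1..1}. poly q x))"
    if q: "q \<in> kernel_polys CARD('n) d k" for q
  \<comment> \<open>The slack \<open>e\<close> keeps the scaling factor positive when \<open>q\<close> has minimum \<open>1\<close>.\<close>
  proof (rule ereal_le_epsilon2)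
    fix e :: real assume "0 < e"
    define M where "M = (INF x\<in>{-1..1}. poly q x)"
    have M: "M \<le> poly q x" if "x \<in> {-1..1}" for x
      using poly_INF_attained[of q] that by (auto simp: M_def)
    have "M \<le> 1" by (rule kernel_poly_lower_bound_le_1[OF q M])
    then have "?S \<le> ereal (1 - M + e)"
      using \<open>0 < e\<close> dual_base_approx_ge[OF q \<open>k \<ge> d\<close> M]
      by (intro scaling_constant_le[OF \<open>d \<ge> 1\<close>]) fastforce+
    then show "?S \<le> ereal (1 - (INF x\<in>{-1..1}. poly q x)) + ereal e"
      by (simp add: M_def)
  qed
  have "kernel_polys CARD('n) d k \<noteq> {}" by (auto simp: kernel_polys_def)
  then have "1 - (SUP q \<in> kernel_polys CARD('n) d k. ereal (INF x\<in>{-1..1}. poly q x))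
      = (INF q \<in> kernel_polys CARD('n) d k. 1 - ereal (INF x\<in>{-1..1}. poly q x))"
    by (subst INF_ereal_minus_right) auto
  moreover have "?S \<le> \<dots>"
    using bound by (intro INF_greatest) (simp add: one_ereal_def)
  ultimately show ?thesis using bound by simp
qed

end
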